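(* Let $\Gamma=(V,E)$ be a finite graph and let $n\geq 3$ be an integer. Let $\mathbb{V}$ be a real vector space of dimension $n$. Then there is a nonempty Zariski open subset $U\subseteq M_{1,n}(\Gamma)$ such that for every motion sheaf $\mathcal{M}\in U$ one has: $H^{1}(I(\Gamma),\mathcal{M})=0$ if and only if the multigraph $(n-2)\Gamma$ is $(n-1,n)$-sparse.
   Context: Cellular sheaves: a sheaf $\mathcal{F}$ on a (multi)graph $\Gamma=(V,E)$ assigns a finite-dimensional real vector space $\mathcal{F}(v)$ to each vertex, $\mathcal{F}(e)$ to each edge, and a linear map $r^{v}_{e}:\mathcal{F}(v)\to\mathcal{F}(e)$ to each vertex-edge incidence. Choosing signs $[v:e]=\pm1$ with $[v:e]=-[u:e]$ for each edge $e=vu$, the coboundary is $d:\bigoplus_{v}\mathcal{F}(v)\to\bigoplus_{e}\mathcal{F}(e)$, $d((w_v)_v)=(\sum_{v\in e}[v:e]r^v_e(w_v))_e$; $H^0(\Gamma,\mathcal{F})=\ker d$ and $H^1(\Gamma,\mathcal{F})=\operatorname{coker} d$. Incidence graph: for a hypergraph $\Gamma=(V,E)$, $I(\Gamma)$ is the graph with vertex set $V\cup E$ and an edge, written $v\sim e$, for each pair with $v\in e$. Motion sheaves: given subspaces $S_v\leq\mathbb{V}$ for $v\in V$, put $S(e)=\bigcap_{v\in e}S_v$. The motion sheaf $\mathcal{M}$ on $I(\Gamma)$ has $\mathcal{M}(v)=\mathbb{V}/S_v$, $\mathcal{M}(e)=\mathbb{V}/S(e)$, $\mathcal{M}(v\sim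 e)=\mathbb{V}/S_v$, with restriction map $\mathcal{M}(v)\to\mathcal{M}(v\sim e)$ the identity and $\mathcal{M}(e)\to\mathcal{M}(v\sim e)$ the reduction modulo $S_v$. $M_{s,n}(\Gamma)$ is the set of motion sheaves with $\dim\mathbb{V}=n$ and all $S_v$ of dimension $s$; it is identified with $\mathrm{Gr}(s,\mathbb{V})^{|V|}$, a real algebraic variety (real points only), where after fixing a basis and inner product $\mathbb{V}\cong\mathbb{R}^n$, $\mathrm{Gr}(s,\mathbb{R}^n)$ is the affine variety of orthogonal projections $P\in\mathbb{R}^{n\times n}$ with $P=P^t$, $P^2=P$, $\mathrm{Tr}(P)=s$ (a subspace corresponds to the projection onto it). Zariski topology refers to this structure. For a graph $\Gamma$ and $a\in\mathbb{N}$, $a\Gamma$ is the multigraph on $V$ with $a$ parallel copies of each edge. A multigraph is $(d,\ell)$-sparse if for every $V'\subseteq V$ with $|V'|\geq 2$, the number of edges (counted with multiplicity) with both endpoints in $V'$ is at most $d|V'|-\ell$. *)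

theory Defs
  imports "HOL-Analysis.Analysis" "HOL-Algebra.AbelCoset" "HOL-Algebra.Module"
begin

section \<open>Real vector spaces with explicit carriers\<close>

text \<open>
  The stalks of a sheaf vary from cell to cell, so they are modules in the sense of
  HOL-Algebra over the field of real numbers.  The record type of modules extends that of rings;
  the fields \<open>mult\<close> and \<open>one\<close> play no role for a module and are left undefined.
\<close>

definition real_field :: "real ring"
  where "real_field = \<lparr>carrier = UNIV, mult = (*), one = 1, zero = 0, add = (+)\<rparr>"

definition type_space :: "(real, 'a::real_vector) module"
  where "type_space = \<lparr>carrier = UNIV, mult = undefined, one = undefined,
    zero = 0, add = (+), smult = (*\<^sub>R)\<rparr>"

definition quotient_space :: "(real, 'b) module \<Rightarrow> 'b set \<Rightarrow> (real, 'b set) module"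
  where "quotient_space M N = \<lparr>carrier = a_rcosets\<^bsub>M\<^esub> N, mult = undefined, one = undefined,
    zero = N, add = set_add M, smult = (\<lambda>c X. \<Union>x\<in>X. N +>\<^bsub>M\<^esub> (c \<odot>\<^bsub>M\<^esub> x))\<rparr>"

text \<open>For infinite \<open>I\<close> this is the direct product; it is only used for finite \<open>I\<close>.\<close>

definition direct_sum :: "'i set \<Rightarrow> ('i \<Rightarrow> (real, 'b) module) \<Rightarrow> (real, 'i \<Rightarrow> 'b) module"
  where "direct_sum I M = \<lparr>carrier = (\<Pi>\<^sub>E i\<in>I. carrier (M i)), mult = undefined, one = undefined,
    zero = (\<lambda>i\<in>I. \<zero>\<^bsub>M i\<^esub>), add = (\<lambda>f g. \<lambda>i\<in>I. f i \<oplus>\<^bsub>M i\<^esub> g i),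
    smult = (\<lambda>c f. \<lambda>i\<in>I. c \<odot>\<^bsub>M i\<^esub> f i)\<rparr>"

definition zero_space :: "(real, 'b) module \<Rightarrow> bool"
  where "zero_space M \<longleftrightarrow> carrier M = {\<zero>\<^bsub>M\<^esub>}"

definition fin_dim_space :: "(real, 'b) module \<Rightarrow> bool"
  where "fin_dim_space M \<longleftrightarrow> module real_field M \<and>
    (\<exists>k b. b \<in> {..<k::nat} \<rightarrow> carrier M \<and>
      (\<forall>x\<in>carrier M. \<exists>c. x = (\<Oplus>\<^bsub>M\<^esub>i\<in>{..<k}. c i \<odot>\<^bsub>M\<^esub> b i)))"

definition linear_map :: "(real, 'b) module \<Rightarrow> (real, 'c) module \<Rightarrow> ('b \<Rightarrow> 'c) \<Rightarrow> bool"
  where "linear_map M N f \<longleftrightarrow> f \<in> carrier M \<rightarrow> carrier N \<and>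
    (\<forall>x\<in>carrier M. \<forall>y\<in>carrier M. f (x \<oplus>\<^bsub>M\<^esub> y) = f x \<oplus>\<^bsub>N\<^esub> f y) \<and>
    (\<forall>c. \<forall>x\<in>carrier M. f (c \<odot>\<^bsub>M\<^esub> x) = c \<odot>\<^bsub>N\<^esub> f x)"


section \<open>Graphs\<close>

definition simple_graph :: "'v set \<Rightarrow> 'v set set \<Rightarrow> bool"
  where "simple_graph V E \<longleftrightarrow> finite V \<and> E \<subseteq> {e. e \<subseteq> V \<and> card e = 2}"

record ('v, 'e) multigraph =
  verts :: "'v set"
  edges :: "'e set"
  ends :: "'e \<Rightarrow> 'v set"

definition multiple_graph :: "nat \<Rightarrow> 'v set \<Rightarrow> 'v set set \<Rightarrow> ('v, 'v set \<times> nat) multigraph"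
  where "multiple_graph a V E = \<lparr>verts = V, edges = E \<times> {..<a}, ends = fst\<rparr>"

definition sparse_graph :: "nat \<Rightarrow> nat \<Rightarrow> ('v, 'e) multigraph \<Rightarrow> bool"
  where "sparse_graph d l G \<longleftrightarrow> (\<forall>W \<subseteq> verts G. card W \<ge> 2 \<longrightarrow>
    int (card {e \<in> edges G. ends G e \<subseteq> W}) \<le> int d * int (card W) - int l)"

definition incidence_graph :: "'v set \<Rightarrow> 'v set set \<Rightarrow> ('v + 'v set, 'v \<times> 'v set) multigraph"
  where "incidence_graph V E = \<lparr>verts = Inl ` V \<union> Inr ` E, edges = {(v, e). v \<in> V \<and> e \<in> E \<and> v \<in> e},
    ends = (\<lambda>(v, e). {Inl v, Inr e})\<rparr>"


section \<open>Cellular sheaves on multigraphs\<close>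

record ('v, 'e, 'b) sheaf =
  vstalk :: "'v \<Rightarrow> (real, 'b) module"
  estalk :: "'e \<Rightarrow> (real, 'b) module"
  restr :: "'v \<Rightarrow> 'e \<Rightarrow> 'b \<Rightarrow> 'b"

definition cellular_sheaf :: "('v, 'e) multigraph \<Rightarrow> ('v, 'e, 'b) sheaf \<Rightarrow> bool"
  where "cellular_sheaf G F \<longleftrightarrow>
    (\<forall>v\<in>verts G. fin_dim_space (vstalk F v)) \<and>
    (\<forall>e\<in>edges G. fin_dim_space (estalk F e)) \<and>
    (\<forall>e\<in>edges G. \<forall>v\<in>ends G e. linear_map (vstalk F v) (estalk F e) (restr F v e))"

definition incidence_signs :: "('v, 'e) multigraph \<Rightarrow> ('v \<Rightarrow> 'e \<Rightarrow> real) \<Rightarrow> bool"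
  where "incidence_signs G \<sigma> \<longleftrightarrow> (\<forall>e\<in>edges G.
    (\<forall>v\<in>ends G e. \<sigma> v e \<in> {1, -1}) \<and>
    (\<forall>u\<in>ends G e. \<forall>v\<in>ends G e. u \<noteq> v \<longrightarrow> \<sigma> v e = - \<sigma> u e))"

definition cochains0 :: "('v, 'e) multigraph \<Rightarrow> ('v, 'e, 'b) sheaf \<Rightarrow> (real, 'v \<Rightarrow> 'b) module"
  where "cochains0 G F = direct_sum (verts G) (vstalk F)"

definition cochains1 :: "('v, 'e) multigraph \<Rightarrow> ('v, 'e, 'b) sheaf \<Rightarrow> (real, 'e \<Rightarrow> 'b) module"
  where "cochains1 G F = direct_sum (edges G) (estalk F)"

definition coboundary ::
    "('v, 'e) multigraph \<Rightarrow> ('v, 'e, 'b) sheaf \<Rightarrow> ('v \<Rightarrow> 'e \<Rightarrow> real) \<Rightarrow> ('v \<Rightarrow> 'b) \<Rightarrow> ('e \<Rightarrow> 'b)"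
  where "coboundary G F \<sigma> w =
    (\<lambda>e\<in>edges G. \<Oplus>\<^bsub>estalk F e\<^esub>v\<in>ends G e. \<sigma> v e \<odot>\<^bsub>estalk F e\<^esub> restr F v e (w v))"

definition cohomology1 ::
    "('v, 'e) multigraph \<Rightarrow> ('v, 'e, 'b) sheaf \<Rightarrow> ('v \<Rightarrow> 'e \<Rightarrow> real) \<Rightarrow> (real, ('e \<Rightarrow> 'b) set) module"
  where "cohomology1 G F \<sigma> =
    quotient_space (cochains1 G F) (coboundary G F \<sigma> ` carrier (cochains0 G F))"


section \<open>Motion sheaves\<close>

text \<open>
  On a coset \<open>X\<close> of \<open>\<Inter>v\<in>e. S v\<close>, reduction modulo \<open>S v\<close> is \<open>X + S v\<close>.
  The summand \<open>Inl\<close> stands for the vertices and \<open>Inr\<close> for the hyperedges.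
\<close>

definition motion_sheaf ::
    "('v \<Rightarrow> 'a::real_vector set) \<Rightarrow> ('v + 'v set, 'v \<times> 'v set, 'a set) sheaf"
  where "motion_sheaf S = \<lparr>
    vstalk = case_sum (\<lambda>v. quotient_space type_space (S v))
                      (\<lambda>e. quotient_space type_space (\<Inter>v\<in>e. S v)),
    estalk = (\<lambda>(v, e). quotient_space type_space (S v)),
    restr = (\<lambda>x (v, e). case x of Inl _ \<Rightarrow> (\<lambda>X. X) | Inr _ \<Rightarrow> (\<lambda>X. X <+>\<^bsub>type_space\<^esub> S v))\<rparr>"

text \<open>A motion sheaf is identified with the family of subspaces that defines it.\<close>

definition motion_sheaves :: "nat \<Rightarrow> 'v set \<Rightarrow> ('v \<Rightarrow> 'a::real_vector set) set"
  where "motion_sheaves s V = (\<Pi>\<^sub>E v\<in>V. {S. subspace S \<and> dim S = s})"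


section \<open>The Zariski topology on tuples of subspaces\<close>

definition grassmannian :: "nat \<Rightarrow> (real^'n^'n) set"
  where "grassmannian s = {P. transpose P = P \<and> P ** P = P \<and> trace P = real s}"

text \<open>Polynomials in the entries of a family of matrices indexed by \<open>V\<close>.\<close>

inductive_set polynomial_functions :: "'v set \<Rightarrow> (('v \<Rightarrow> real^'n^'n) \<Rightarrow> real) set"
  for V :: "'v set"
where
  const: "(\<lambda>P. c) \<in> polynomial_functions V"
| entry: "v \<in> V \<Longrightarrow> (\<lambda>P. P v $ i $ j) \<in> polynomial_functions V"
| add: "\<lbrakk>p \<in> polynomial_functions V; q \<in> polynomial_functions V\<rbrakk>
    \<Longrightarrow> (\<lambda>P. p P + q P) \<in> polynomial_functions V"
| mult: "\<lbrakk>p \<in> polynomial_functions V; q \<in> polynomial_functions V\<rbrakk>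
    \<Longrightarrow> (\<lambda>P. p P * q P) \<in> polynomial_functions V"

definition zariski_closed_in ::
    "'v set \<Rightarrow> ('v \<Rightarrow> real^'n^'n) set \<Rightarrow> ('v \<Rightarrow> real^'n^'n) set \<Rightarrow> bool"
  where "zariski_closed_in V X Z \<longleftrightarrow>
    (\<exists>Q \<subseteq> polynomial_functions V. Z = {P \<in> X. \<forall>q\<in>Q. q P = 0})"

text \<open>
  An isomorphism \<open>\<phi>\<close> from \<open>\<real>\<^sup>n\<close> onto the ambient space (a choice of a basis, together with the inner
  product for which it is orthonormal) lets a projection matrix stand for the image of its range.
  The Zariski topology on families of subspaces is transported along this bijection.
\<close>

definition subspace_family ::
    "(real^'n \<Rightarrow> 'a::real_vector) \<Rightarrow> 'v set \<Rightarrow> ('v \<Rightarrow> real^'n^'n) \<Rightarrow> ('v \<Rightarrow> 'a set)"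
  where "subspace_family \<phi> V P = (\<lambda>v\<in>V. \<phi> ` range (\<lambda>x. P v *v x))"

definition zariski_open ::
    "(real^'n \<Rightarrow> 'a::real_vector) \<Rightarrow> nat \<Rightarrow> 'v set \<Rightarrow> ('v \<Rightarrow> 'a set) set \<Rightarrow> bool"
  where "zariski_open \<phi> s V U \<longleftrightarrow> U \<subseteq> motion_sheaves s V \<and>
    zariski_closed_in V (\<Pi>\<^sub>E v\<in>V. grassmannian s)
      {P \<in> (\<Pi>\<^sub>E v\<in>V. grassmannian s). subspace_family \<phi> V P \<notin> U}"


section \<open>Motion sheaves are cellular sheaves\<close>

lemma cring_real_field: "cring real_field"
proof (rule cringI)
  show "abelian_group real_field"
  proof (rule abelian_groupI)
    fix x :: real
    show "\<exists>y\<in>carrier real_field. y \<oplus>\<^bsub>real_field\<^esub> x = \<zero>\<^bsub>real_field\<^esub>"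
      by (rule bexI[of _ "- x"]) (simp_all add: real_field_def)
  qed (simp_all add: real_field_def)
  show "comm_monoid real_field"
    by (rule comm_monoidI) (simp_all add: real_field_def)
qed (simp_all add: real_field_def distrib_right)

lemma module_type_space: "module real_field (type_space :: (real, 'a::real_vector) module)"
proof (rule moduleI)
  show "cring real_field" by (rule cring_real_field)
  show "abelian_group (type_space :: (real, 'a) module)"
  proof (rule abelian_groupI)
    fix x :: 'a
    show "\<exists>y\<in>carrier type_space. y \<oplus>\<^bsub>type_space\<^esub> x = \<zero>\<^bsub>type_space\<^esub>"
      by (rule bexI[of _ "- x"]) (simp_all add: type_space_def)
  qed (simp_all add: type_space_def add_ac)
qed (simp_all add: type_space_def real_field_def scaleR_add_left scaleR_add_right)

lemma submodule_type_space:
  assumes "subspace S"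
  shows "submodule S real_field type_space"
proof (rule module.submoduleI[OF module_type_space])
  interpret module real_field "type_space :: (real, 'a) module" by (rule module_type_space)
  fix a :: 'a assume "a \<in> S"
  have "\<ominus>\<^bsub>type_space\<^esub> a = - a"
    by (rule minus_equality) (simp_all add: type_space_def)
  then show "\<ominus>\<^bsub>type_space\<^esub> a \<in> S"
    using \<open>a \<in> S\<close> assms by (simp add: subspace_neg)
qed (use assms in \<open>auto simp: type_space_def subspace_add subspace_scale subspace_0\<close>)

lemma abelian_subgroup_submodule:
  assumes "module R M" and "submodule N R M"
  shows "abelian_subgroup N M"
  using assms by (intro abelian_subgroupI3 additive_subgroup.intro)
    (auto simp: module_def submodule_def)

lemma quotient_smult_coset:
  assumes "module real_field M" and "submodule N real_field M" and x: "x \<in> carrier M"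
  shows "c \<odot>\<^bsub>quotient_space M N\<^esub> (N +>\<^bsub>M\<^esub> x) = N +>\<^bsub>M\<^esub> (c \<odot>\<^bsub>M\<^esub> x)"
proof -
  interpret module real_field M by fact
  interpret N: submodule N real_field M by fact
  interpret A: abelian_subgroup N M by (rule abelian_subgroup_submodule[OF assms(1,2)])
  have c: "c \<in> carrier real_field" by (simp add: real_field_def)
  have "N +>\<^bsub>M\<^esub> (c \<odot>\<^bsub>M\<^esub> (h \<oplus>\<^bsub>M\<^esub> x)) = N +>\<^bsub>M\<^esub> (c \<odot>\<^bsub>M\<^esub> x)" if "h \<in> N" for h
  proof -
    have h: "h \<in> carrier M" using that by simp
    have "c \<odot>\<^bsub>M\<^esub> h \<in> N" using c that by (rule N.smult_closed)
    then have "c \<odot>\<^bsub>M\<^esub> h \<oplus>\<^bsub>M\<^esub> c \<odot>\<^bsub>M\<^esub> x \<in> N +>\<^bsub>M\<^esub> (c \<odot>\<^bsub>M\<^esub> x)"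
      by (auto simp: a_r_coset_def')
    then show ?thesis
      using A.a_repr_independence'[of _ "c \<odot>\<^bsub>M\<^esub> x"] smult_r_distr[OF c h x] smult_closed[OF c x]
      by metis
  qed
  moreover have "N +>\<^bsub>M\<^esub> x = (\<lambda>h. h \<oplus>\<^bsub>M\<^esub> x) ` N" by (auto simp: a_r_coset_def')
  moreover have "N \<noteq> {}" using A.zero_closed by blast
  ultimately show ?thesis by (auto simp: quotient_space_def)
qed

lemma module_quotient_space:
  assumes M: "module real_field M" and N: "submodule N real_field M"
  shows "module real_field (quotient_space M N)"
proof (rule moduleI)
  interpret module real_field M by fact
  interpret N: submodule N real_field M by fact
  interpret A: abelian_subgroup N M by (rule abelian_subgroup_submodule[OF M N])
  let ?Q = "quotient_space M N"
  show "cring real_field" by (rule cring_real_field)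
  have car: "\<exists>x\<in>carrier M. X = N +>\<^bsub>M\<^esub> x" if "X \<in> carrier ?Q" for X
    using that by (auto simp: quotient_space_def A_RCOSETS_def')
  have mem: "N +>\<^bsub>M\<^esub> x \<in> carrier ?Q" if "x \<in> carrier M" for x
    using that by (auto simp: quotient_space_def A_RCOSETS_def')
  have add: "(N +>\<^bsub>M\<^esub> x) \<oplus>\<^bsub>?Q\<^esub> (N +>\<^bsub>M\<^esub> y) = N +>\<^bsub>M\<^esub> (x \<oplus>\<^bsub>M\<^esub> y)"
    if "x \<in> carrier M" "y \<in> carrier M" for x y
    using A.a_rcos_sum[OF that] by (simp add: quotient_space_def)
  have zero: "\<zero>\<^bsub>?Q\<^esub> = N +>\<^bsub>M\<^esub> \<zero>\<^bsub>M\<^esub>"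
    using a_coset_add_zero[OF A.a_subset] by (simp add: quotient_space_def)
  show "abelian_group ?Q"
  proof (rule abelian_groupI)
    show "X \<oplus>\<^bsub>?Q\<^esub> Y \<in> carrier ?Q" if "X \<in> carrier ?Q" "Y \<in> carrier ?Q" for X Y
      using car[OF that(1)] car[OF that(2)] by (auto simp: add intro!: mem)
    show "\<zero>\<^bsub>?Q\<^esub> \<in> carrier ?Q" by (simp add: zero mem)
    show "X \<oplus>\<^bsub>?Q\<^esub> Y \<oplus>\<^bsub>?Q\<^esub> Z = X \<oplus>\<^bsub>?Q\<^esub> (Y \<oplus>\<^bsub>?Q\<^esub> Z)"
      if "X \<in> carrier ?Q" "Y \<in> carrier ?Q" "Z \<in> carrier ?Q" for X Y Z
      using car[OF that(1)] car[OF that(2)] car[OF that(3)] by (auto simp: add a_assoc)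
    show "X \<oplus>\<^bsub>?Q\<^esub> Y = Y \<oplus>\<^bsub>?Q\<^esub> X" if "X \<in> carrier ?Q" "Y \<in> carrier ?Q" for X Y
      using car[OF that(1)] car[OF that(2)] by (auto simp: add a_comm)
    show "\<zero>\<^bsub>?Q\<^esub> \<oplus>\<^bsub>?Q\<^esub> X = X" if "X \<in> carrier ?Q" for X
      using car[OF that] by (auto simp: add zero)
    show "\<exists>Y\<in>carrier ?Q. Y \<oplus>\<^bsub>?Q\<^esub> X = \<zero>\<^bsub>?Q\<^esub>" if X: "X \<in> carrier ?Q" for X
    proof -
      obtain x where x: "x \<in> carrier M" "X = N +>\<^bsub>M\<^esub> x" using car[OF X] by blast
      then show ?thesis
        by (intro bexI[of _ "N +>\<^bsub>M\<^esub> (\<ominus>\<^bsub>M\<^esub> x)"]) (simp_all add: add zero mem l_neg)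
    qed
  qed
  note sm = quotient_smult_coset[OF M N]
  show "a \<odot>\<^bsub>?Q\<^esub> X \<in> carrier ?Q" if "a \<in> carrier real_field" "X \<in> carrier ?Q" for a X
    using car[OF that(2)] that(1) by (auto simp: sm intro!: mem)
  show "(a \<oplus>\<^bsub>real_field\<^esub> b) \<odot>\<^bsub>?Q\<^esub> X = (a \<odot>\<^bsub>?Q\<^esub> X) \<oplus>\<^bsub>?Q\<^esub> (b \<odot>\<^bsub>?Q\<^esub> X)"
    if "a \<in> carrier real_field" "b \<in> carrier real_field" "X \<in> carrier ?Q" for a b X
    using car[OF that(3)] that(1,2) by (auto simp: sm add smult_l_distr)
  show "a \<odot>\<^bsub>?Q\<^esub> (X \<oplus>\<^bsub>?Q\<^esub> Y) = (a \<odot>\<^bsub>?Q\<^esub> X) \<oplus>\<^bsub>?Q\<^esub> (a \<odot>\<^bsub>?Q\<^esub> Y)"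
    if "a \<in> carrier real_field" "X \<in> carrier ?Q" "Y \<in> carrier ?Q" for a X Y
    using car[OF that(2)] car[OF that(3)] that(1) by (auto simp: sm add smult_r_distr)
  show "(a \<otimes>\<^bsub>real_field\<^esub> b) \<odot>\<^bsub>?Q\<^esub> X = a \<odot>\<^bsub>?Q\<^esub> (b \<odot>\<^bsub>?Q\<^esub> X)"
    if "a \<in> carrier real_field" "b \<in> carrier real_field" "X \<in> carrier ?Q" for a b X
    using car[OF that(3)] that(1,2) by (auto simp: sm smult_assoc1)
  show "\<one>\<^bsub>real_field\<^esub> \<odot>\<^bsub>?Q\<^esub> X = X" if "X \<in> carrier ?Q" for X
    using car[OF that] by (auto simp: sm)
qed

lemma quotient_coset_sum:
  fixes b :: "nat \<Rightarrow> 'a::real_vector"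
  assumes "subspace S"
  shows "S +>\<^bsub>type_space\<^esub> (\<Sum>i<k. c i *\<^sub>R b i) =
    (\<Oplus>\<^bsub>quotient_space type_space S\<^esub>i\<in>{..<k}.
      c i \<odot>\<^bsub>quotient_space type_space S\<^esub> (S +>\<^bsub>type_space\<^esub> b i))"
proof -
  let ?T = "type_space :: (real, 'a) module" and ?Q = "quotient_space type_space S"
  note N = submodule_type_space[OF assms]
  interpret A: abelian_subgroup S ?T by (rule abelian_subgroup_submodule[OF module_type_space N])
  interpret Q: module real_field ?Q by (rule module_quotient_space[OF module_type_space N])
  have sm: "c \<odot>\<^bsub>?Q\<^esub> (S +>\<^bsub>?T\<^esub> x) = S +>\<^bsub>?T\<^esub> (c *\<^sub>R x)" for c x
    using quotient_smult_coset[OF module_type_space N, of x c] by (simp add: type_space_def)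
  have mem: "S +>\<^bsub>?T\<^esub> x \<in> carrier ?Q" for x
    by (auto simp: quotient_space_def A_RCOSETS_def' type_space_def)
  have add: "(S +>\<^bsub>?T\<^esub> x) \<oplus>\<^bsub>?Q\<^esub> (S +>\<^bsub>?T\<^esub> y) = S +>\<^bsub>?T\<^esub> (x + y)" for x y
    using A.a_rcos_sum[of x y] by (simp add: quotient_space_def type_space_def)
  show ?thesis
  proof (induction k)
    case 0
    have "S +>\<^bsub>?T\<^esub> 0 = S" by (auto simp: a_r_coset_def' type_space_def)
    then have "S +>\<^bsub>?T\<^esub> 0 = \<zero>\<^bsub>?Q\<^esub>" by (simp add: quotient_space_def)
    then show ?case by simp
  next
    case (Suc k)
    have "(\<Oplus>\<^bsub>?Q\<^esub>i\<in>insert k {..<k}. c i \<odot>\<^bsub>?Q\<^esub> (S +>\<^bsub>?T\<^esub> b i)) =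
      (S +>\<^bsub>?T\<^esub> (c k *\<^sub>R b k)) \<oplus>\<^bsub>?Q\<^esub> (S +>\<^bsub>?T\<^esub> (\<Sum>i<k. c i *\<^sub>R b i))"
      by (subst Q.finsum_insert) (simp_all add: Suc sm mem)
    then show ?case by (simp add: add lessThan_Suc)
  qed
qed

lemma fin_dim_quotient_space:
  assumes S: "subspace (S :: 'a::real_vector set)" and B: "finite B" "span B = (UNIV :: 'a set)"
  shows "fin_dim_space (quotient_space type_space S)"
proof -
  let ?T = "type_space :: (real, 'a) module" and ?Q = "quotient_space type_space S"
  obtain b where b: "bij_betw b {..<card B} B"
    using ex_bij_betw_nat_finite[OF B(1)] by (auto simp: atLeast0LessThan)
  have "\<exists>c. X = (\<Oplus>\<^bsub>?Q\<^esub>i\<in>{..<card B}. c i \<odot>\<^bsub>?Q\<^esub> (S +>\<^bsub>?T\<^esub> b i))" if X: "X \<in> carrier ?Q" for X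
  proof -
    obtain x where x: "X = S +>\<^bsub>?T\<^esub> x"
      using X by (auto simp: quotient_space_def A_RCOSETS_def')
    have "x \<in> span B" using B(2) by simp
    then obtain u where "x = (\<Sum>v\<in>B. u v *\<^sub>R v)" using span_finite[OF B(1)] by auto
    also have "\<dots> = (\<Sum>i<card B. u (b i) *\<^sub>R b i)"
      by (rule sum.reindex_bij_betw[OF b, symmetric])
    finally show ?thesis
      unfolding x by (intro exI[of _ "\<lambda>i. u (b i)"]) (simp only: quotient_coset_sum[OF S])
  qed
  moreover have "(\<lambda>i. S +>\<^bsub>?T\<^esub> b i) \<in> {..<card B} \<rightarrow> carrier ?Q"
    by (auto simp: quotient_space_def A_RCOSETS_def' type_space_def)
  ultimately show ?thesis
    using module_quotient_space[OF module_type_space submodule_type_space[OF S]]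
    unfolding fin_dim_space_def by blast
qed

lemma linear_map_reduction:
  assumes "subspace S" and "subspace S'" and "S \<subseteq> S'"
  shows "linear_map (quotient_space type_space S) (quotient_space type_space S')
    (\<lambda>X. X <+>\<^bsub>type_space\<^esub> S')"
proof -
  let ?T = "type_space :: (real, 'a::real_vector) module"
  let ?Q = "quotient_space type_space S" and ?Q' = "quotient_space type_space S'"
  note N = submodule_type_space[OF assms(1)] and N' = submodule_type_space[OF assms(2)]
  interpret A: abelian_subgroup S ?T by (rule abelian_subgroup_submodule[OF module_type_space N])
  interpret A': abelian_subgroup S' ?T by (rule abelian_subgroup_submodule[OF module_type_space N'])
  have red: "(S +>\<^bsub>?T\<^esub> x) <+>\<^bsub>?T\<^esub> S' = S' +>\<^bsub>?T\<^esub> x" for x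
  proof (rule equalityI; rule subsetI)
    fix y assume "y \<in> (S +>\<^bsub>?T\<^esub> x) <+>\<^bsub>?T\<^esub> S'"
    then obtain s t where "s \<in> S" "t \<in> S'" "y = s + x + t"
      by (auto simp: set_add_def' a_r_coset_def' type_space_def)
    then have "s + t \<in> S'" "y = (s + t) + x"
      using assms subspace_add[of S' s t] by (auto simp: algebra_simps)
    then show "y \<in> S' +>\<^bsub>?T\<^esub> x"
      by (auto simp: a_r_coset_def' type_space_def)
  next
    fix y assume "y \<in> S' +>\<^bsub>?T\<^esub> x"
    then obtain t where "t \<in> S'" "y = 0 + x + t"
      by (auto simp: a_r_coset_def' type_space_def add.commute)
    moreover have "0 + x \<in> S +>\<^bsub>?T\<^esub> x"
      using subspace_0[OF assms(1)] by (force simp: a_r_coset_def' type_space_def)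
    ultimately show "y \<in> (S +>\<^bsub>?T\<^esub> x) <+>\<^bsub>?T\<^esub> S'"
      by (auto simp: set_add_def' type_space_def)
  qed
  have car: "\<exists>x. X = S +>\<^bsub>?T\<^esub> x" if "X \<in> carrier ?Q" for X
    using that by (auto simp: quotient_space_def A_RCOSETS_def')
  have mem: "S' +>\<^bsub>?T\<^esub> x \<in> carrier ?Q'" for x
    by (auto simp: quotient_space_def A_RCOSETS_def' type_space_def)
  have sm: "c \<odot>\<^bsub>?Q\<^esub> (S +>\<^bsub>?T\<^esub> x) = S +>\<^bsub>?T\<^esub> (c *\<^sub>R x)"
    "c \<odot>\<^bsub>?Q'\<^esub> (S' +>\<^bsub>?T\<^esub> x) = S' +>\<^bsub>?T\<^esub> (c *\<^sub>R x)" for c x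
    using quotient_smult_coset[OF module_type_space N, of x c]
      quotient_smult_coset[OF module_type_space N', of x c] by (simp_all add: type_space_def)
  have add: "(S +>\<^bsub>?T\<^esub> x) \<oplus>\<^bsub>?Q\<^esub> (S +>\<^bsub>?T\<^esub> y) = S +>\<^bsub>?T\<^esub> (x + y)"
    "(S' +>\<^bsub>?T\<^esub> x) \<oplus>\<^bsub>?Q'\<^esub> (S' +>\<^bsub>?T\<^esub> y) = S' +>\<^bsub>?T\<^esub> (x + y)" for x y
    using A.a_rcos_sum[of x y] A'.a_rcos_sum[of x y] by (simp_all add: quotient_space_def type_space_def)
  show ?thesis
    unfolding linear_map_def
  proof (intro conjI ballI allI funcsetI)
    fix X assume "X \<in> carrier ?Q"
    then obtain x where x: "X = S +>\<^bsub>?T\<^esub> x" using car by blast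
    show "X <+>\<^bsub>?T\<^esub> S' \<in> carrier ?Q'" unfolding x red by (rule mem)
    show "c \<odot>\<^bsub>?Q\<^esub> X <+>\<^bsub>?T\<^esub> S' = c \<odot>\<^bsub>?Q'\<^esub> (X <+>\<^bsub>?T\<^esub> S')" for c
      unfolding x sm red ..
    fix Y assume "Y \<in> carrier ?Q"
    then obtain y where y: "Y = S +>\<^bsub>?T\<^esub> y" using car by blast
    show "X \<oplus>\<^bsub>?Q\<^esub> Y <+>\<^bsub>?T\<^esub> S' = (X <+>\<^bsub>?T\<^esub> S') \<oplus>\<^bsub>?Q'\<^esub> (Y <+>\<^bsub>?T\<^esub> S')"
      unfolding x y add red ..
  qed
qed

lemma cellular_sheaf_motion_sheaf:
  fixes S :: "'v \<Rightarrow> 'a::real_vector set"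
  assumes S: "\<And>v. v \<in> V \<Longrightarrow> subspace (S v)" and E: "\<And>e. e \<in> E \<Longrightarrow> e \<subseteq> V"
    and B: "finite B" "span B = (UNIV :: 'a set)"
  shows "cellular_sheaf (incidence_graph V E) (motion_sheaf S)"
proof -
  have Se: "subspace (\<Inter>v\<in>e. S v)" if "e \<in> E" for e
    using S E[OF that] by (auto intro!: subspace_Inter)
  have id: "linear_map M M (\<lambda>X. X)" for M :: "(real, 'a set) module"
    by (simp add: linear_map_def)
  show ?thesis
    unfolding cellular_sheaf_def
    using fin_dim_quotient_space[OF S B] fin_dim_quotient_space[OF Se B] id
      linear_map_reduction[OF Se S]
    by (auto simp: incidence_graph_def motion_sheaf_def INF_lower)
qed

end

theory Submission
  imports Defs "HOL-Analysis.Finite_Function_Topology"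
begin

text \<open>
  Since the signs can be absorbed, \<open>H\<^sup>1 = 0\<close> says that all systems \<open>a v - b e \<in> y v e + S v\<close>
  (\<open>v \<in> e\<close>) are solvable. Dually, there is no nonzero stress: a family of vectors \<open>f v e\<close>
  orthogonal to \<open>S v\<close> whose sums at every vertex and over every edge vanish. For distinct lines, the
  edges inside \<open>W\<close> contribute \<open>n - 2\<close> independent vectors each to the kernel of the surjective
  total sum from the \<open>(n - 1) * card W\<close>-dimensional space of families \<open>g v\<close> orthogonal to \<open>S v\<close>
  onto \<open>\<real>\<^sup>n\<close>, so the absence of stresses forces sparsity.

  Conversely, for points \<open>p v = (q v, 1)\<close> stresses are the linear relations between the parallel redrawing
  equations of \<open>q\<close> in dimension \<open>n - 1\<close>. As in Whiteley's theorem on parallel drawings one first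
  picks the normals of the edges, generically, and then takes for \<open>q\<close> a solution of the resulting
  independent equations. It has distinct ends on every edge because, by sparsity, the equations stay
  independent after one more equation for that edge is added.
\<close>

section \<open>Generic choices in real vector spaces\<close>

text \<open>Since n = (n - 1) + 1, the sparsity inequality for m edges inside W reads (n - 2) m + 1
  <= (n - 1) (|W| - 1). The right side is the dimension of the space of linear equations on the
  differences of |W| points in dimension n - 1; the left side counts n - 2 equations per edge and
  one more. So sparsity is a Hall-type rank condition with one unit to spare, and this unit pays for
  the extra equation of an edge. The obstacle is that at a given configuration the normals of edges
  with a common end are coupled through the points and cannot be perturbed separately. Normals
  chosen first are free of each other, so a greedy choice in the manner of Rado's theorem on
  independent transversals applies. The points then appear as a linear functional on the space of
  equations that vanishes on the chosen ones. On the necessary side the constants are dimensions: n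
  - 1 for the complement of a line, n - 2 for the complement of the plane of two lines, n for the
  target of the total sum.\<close>

lemma independent_family:
  fixes b :: "'i \<Rightarrow> 'b::real_vector"
  assumes "finite I"
    and rel: "\<And>c. (\<Sum>i\<in>I. c i *\<^sub>R b i) = 0 \<Longrightarrow> \<forall>i\<in>I. c i = 0"
  shows "inj_on b I \<and> independent (b ` I)"
proof
  show inj: "inj_on b I"
  proof (rule inj_onI, rule ccontr)
    fix i j assume ij: "i \<in> I" "j \<in> I" "b i = b j" "i \<noteq> j"
    define c :: "'i \<Rightarrow> real" where "c = (\<lambda>l. if l = i then 1 else if l = j then -1 else 0)"
    have "(\<Sum>l\<in>I. c l *\<^sub>R b l) = (\<Sum>l\<in>{i, j}. c l *\<^sub>R b l)"
      using assms(1) ij by (intro sum.mono_neutral_right) (auto simp: c_def)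
    also have "\<dots> = 0" using ij by (simp add: c_def)
    finally show False using rel[of c] ij by (auto simp: c_def)
  qed
  show "independent (b ` I)"
  proof (rule independent_if_scalars_zero)
    fix f x assume "(\<Sum>x\<in>b ` I. f x *\<^sub>R x) = 0" and x: "x \<in> b ` I"
    then have "(\<Sum>i\<in>I. f (b i) *\<^sub>R b i) = 0" by (simp add: sum.reindex[OF inj])
    then show "f x = 0" using rel[of "f \<circ> b"] x by auto
  qed (use assms(1) in simp)
qed

lemma independent_family_rel:
  fixes b :: "'i \<Rightarrow> 'b::real_vector"
  assumes "finite I" "inj_on b I" "independent (b ` I)"
    and "(\<Sum>i\<in>I. c i *\<^sub>R b i) = 0" and "i \<in> I"
  shows "c i = 0"
proof -
  have "(\<Sum>x\<in>b ` I. c (inv_into I b x) *\<^sub>R x) = (\<Sum>i\<in>I. c i *\<^sub>R b i)"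
    by (simp add: sum.reindex[OF assms(2)] assms(2))
  then have "c (inv_into I b (b i)) = 0"
    using assms independentD[of "b ` I" "b ` I" "\<lambda>x. c (inv_into I b x)" "b i"] by simp
  then show ?thesis using assms by simp
qed

text \<open>A real vector space is not a finite union of proper subspaces. If the old choice
  \<open>x\<close> lies in the new member \<open>G\<close> and \<open>y\<close> does not, the points
  \<open>y + t *\<^sub>R x\<close> all miss \<open>G\<close>, and each other member contains at most
  one of them.\<close>

lemma subspace_avoid:
  fixes X :: "'b::real_vector set"
  assumes "finite \<G>" "subspace X" "\<And>Y. Y \<in> \<G> \<Longrightarrow> subspace Y \<and> \<not> X \<subseteq> Y"
  shows "\<exists>x\<in>X. \<forall>Y\<in>\<G>. x \<notin> Y"
  using assms(1,3)
proof (induction \<G>)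
  case empty
  then show ?case using subspace_0[OF assms(2)] by blast
next
  case (insert G \<G>)
  then obtain x where x: "x \<in> X" "\<forall>Y\<in>\<G>. x \<notin> Y" by blast
  obtain y where y: "y \<in> X" "y \<notin> G" using insert.prems by blast
  show ?case
  proof (cases "x \<in> G")
    case True
    have one: "t = t'" if "Y \<in> \<G>" "y + t *\<^sub>R x \<in> Y" "y + t' *\<^sub>R x \<in> Y" for Y t t'
    proof (rule ccontr)
      assume "t \<noteq> t'"
      have sY: "subspace Y" using insert.prems that by blast
      have "(t - t') *\<^sub>R x \<in> Y" using subspace_diff[OF sY that(2,3)] by (simp add: algebra_simps)
      then have "(1 / (t - t')) *\<^sub>R ((t - t') *\<^sub>R x) \<in> Y" by (rule subspace_scale[OF sY])
      then show False using x that(1) \<open>t \<noteq> t'\<close> by simp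
    qed
    have "finite {t. y + t *\<^sub>R x \<in> Y}" if "Y \<in> \<G>" for Y
    proof (cases "\<exists>t. y + t *\<^sub>R x \<in> Y")
      case True
      then obtain t where "y + t *\<^sub>R x \<in> Y" by blast
      then have "{t. y + t *\<^sub>R x \<in> Y} \<subseteq> {t}" using one[OF that] by blast
      then show ?thesis using finite_subset by blast
    qed simp
    then have "finite (\<Union>Y\<in>\<G>. {t. y + t *\<^sub>R x \<in> Y})" using insert.hyps by blast
    then obtain t where t: "t \<notin> (\<Union>Y\<in>\<G>. {t. y + t *\<^sub>R x \<in> Y})"
      using ex_new_if_finite infinite_UNIV_char_0 by blast
    have "y + t *\<^sub>R x \<notin> G"
    proof
      assume a: "y + t *\<^sub>R x \<in> G"
      have sG: "subspace G" using insert.prems by blast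
      have "y + t *\<^sub>R x - t *\<^sub>R x \<in> G"
        by (rule subspace_diff[OF sG a subspace_scale[OF sG True]])
      then show False using y by simp
    qed
    moreover have "y + t *\<^sub>R x \<in> X"
      using x y assms(2) by (simp add: subspace_add subspace_scale)
    ultimately show ?thesis using t by (intro bexI[of _ "y + t *\<^sub>R x"]) auto
  qed (use x in blast)
qed

text \<open>
  The representatives are picked one at a time. A subset on which the rank condition is tight forces the
  next representative to avoid a subspace, and tightness prevents that subspace from containing all
  candidates.
\<close>

lemma generic_transversal:
  fixes A :: "'h \<Rightarrow> 'b::real_vector set"
  assumes "finite H" "finite H0" "H \<subseteq> H0" "\<And>h. h \<in> H0 \<Longrightarrow> finite (A h)"
    and "finite D" "independent D"
    and "\<And>F f. F \<subseteq> H \<Longrightarrow> f \<in> H0 \<Longrightarrow> \<exists>B. finite B \<and> independent B \<and>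
      B \<subseteq> span (D \<union> A f \<union> \<Union>(A ` F)) \<and> card F + 1 + card D \<le> card B"
  shows "\<exists>a. (\<forall>h\<in>H. a h \<in> span (A h)) \<and> inj_on a H \<and> a ` H \<inter> D = {} \<and>
    independent (D \<union> a ` H) \<and> (\<forall>f\<in>H0. \<not> A f \<subseteq> span (D \<union> a ` H))"
  using assms(1,3,5-7)
\<comment> \<open>\<open>H\<close> shrinks while the chosen vectors move into \<open>D\<close>.
  \<open>H0\<close> stays fixed, because the spare vector has to remain available for every
  \<open>f\<close> of the original index set.\<close>
proof (induction H arbitrary: D)
  case empty
  have "\<not> A f \<subseteq> span D" if f: "f \<in> H0" for f
  proof
    assume sub: "A f \<subseteq> span D"
    obtain B where B: "independent B" "B \<subseteq> span (D \<union> A f)" "card D < card B"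
      using empty.prems(4)[of "{}" f] f by auto
    have "D \<union> A f \<subseteq> span D" using sub span_superset by blast
    then have "B \<subseteq> span D" using B(2) by (metis span_mono span_span subset_trans)
    then show False using independent_span_bound[OF empty.prems(2) B(1)] B(3) by simp
  qed
  then show ?case using empty by auto
next
  case (insert h H)
  define Sp where "Sp = (\<lambda>F f. span (D \<union> A f \<union> \<Union>(A ` F)))"
  define \<G> where "\<G> = insert (span D) {Y \<in> (\<lambda>(F, f). Sp F f) ` (Pow H \<times> H0). \<not> span (A h) \<subseteq> Y}"
  have h0: "h \<in> H0" using insert.prems by blast
  have nD: "\<not> span (A h) \<subseteq> span D"
  proof
    assume sub: "span (A h) \<subseteq> span D"
    obtain B where B: "independent B" "B \<subseteq> span (D \<union> A h)" "card D < card B"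
      using insert.prems(4)[of "{}" h] h0 by auto
    have "D \<union> A h \<subseteq> span D" using sub span_superset by blast
    then have "B \<subseteq> span D" using B(2) by (metis span_mono span_span subset_trans)
    then show False using independent_span_bound[OF insert.prems(2) B(1)] B(3) by simp
  qed
  have "finite \<G>" using insert.hyps assms(2) by (simp add: \<G>_def)
  moreover have "subspace Y \<and> \<not> span (A h) \<subseteq> Y" if "Y \<in> \<G>" for Y
    using that nD by (auto simp: \<G>_def Sp_def)
  ultimately obtain x where x: "x \<in> span (A h)" "\<And>Y. Y \<in> \<G> \<Longrightarrow> x \<notin> Y"
    using subspace_avoid[of \<G> "span (A h)"] by auto
  have xD: "x \<notin> span D" using x by (simp add: \<G>_def)
  then have xD': "x \<notin> D" using span_superset by blast
  have "\<exists>a. (\<forall>h\<in>H. a h \<in> span (A h)) \<and> inj_on a H \<and> a ` H \<inter> insert x D = {} \<and>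
    independent (insert x D \<union> a ` H) \<and> (\<forall>f\<in>H0. \<not> A f \<subseteq> span (insert x D \<union> a ` H))"
  proof (rule insert.IH)
    show "H \<subseteq> H0" "finite (insert x D)" using insert.prems by auto
    show "independent (insert x D)" using insert.prems xD by (simp add: independent_insertI)
  next
    fix F f assume F: "F \<subseteq> H" and f: "f \<in> H0"
    have cD: "card (insert x D) = card D + 1" using xD' insert.prems(2) by simp
    have sp: "Sp F f \<subseteq> span (insert x D \<union> A f \<union> \<Union>(A ` F))"
      unfolding Sp_def by (intro span_mono) blast
    show "\<exists>B. finite B \<and> independent B \<and> B \<subseteq> span (insert x D \<union> A f \<union> \<Union>(A ` F)) \<and>
      card F + 1 + card (insert x D) \<le> card B"
    \<comment> \<open>If \<open>Sp F f\<close> contains all candidates for \<open>h\<close>, adding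
      \<open>h\<close> to \<open>F\<close> does not enlarge it, and the hypothesis for
      \<open>insert h F\<close> counts one more vector. Otherwise \<open>x\<close> was chosen
      outside \<open>Sp F f\<close> and is itself the additional vector.\<close>
    proof (cases "span (A h) \<subseteq> Sp F f")
      case True
      obtain B where B: "finite B" "independent B" "B \<subseteq> span (D \<union> A f \<union> \<Union>(A ` insert h F))"
        "card (insert h F) + 1 + card D \<le> card B"
        using insert.prems(4)[of "insert h F" f] F f by blast
      have "A h \<subseteq> Sp F f" using True span_superset by blast
      then have "D \<union> A f \<union> \<Union>(A ` insert h F) \<subseteq> Sp F f"
        unfolding Sp_def using span_superset[of "D \<union> A f \<union> \<Union>(A ` F)"] by auto
      then have "span (D \<union> A f \<union> \<Union>(A ` insert h F)) \<subseteq> Sp F f"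
        unfolding Sp_def by (metis span_mono span_span)
      moreover have "card (insert h F) = card F + 1"
        using F insert.hyps finite_subset by (subst card_insert_disjoint) auto
      ultimately show ?thesis using B sp cD by (intro exI[of _ B]) auto
    next
      case False
      then have xn: "x \<notin> Sp F f" using x(2)[of "Sp F f"] F f by (auto simp: \<G>_def)
      obtain B where B: "finite B" "independent B" "B \<subseteq> Sp F f" "card F + 1 + card D \<le> card B"
        unfolding Sp_def using insert.prems(4)[of F f] F f by blast
      have "span B \<subseteq> Sp F f" using B(3) unfolding Sp_def by (metis span_mono span_span)
      then have "x \<notin> span B" "x \<notin> B" using xn B(3) by auto
      moreover have "x \<in> span (insert x D \<union> A f \<union> \<Union>(A ` F))" by (simp add: span_base)
      ultimately show ?thesis
        using B sp cD by (intro exI[of _ "insert x B"]) (auto simp: independent_insertI)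
    qed
  qed
  then obtain a where a: "\<forall>h\<in>H. a h \<in> span (A h)" "inj_on a H" "a ` H \<inter> insert x D = {}"
    "independent (insert x D \<union> a ` H)" "\<forall>f\<in>H0. \<not> A f \<subseteq> span (insert x D \<union> a ` H)" by blast
  define a' where "a' = a(h := x)"
  have im: "a' ` H = a ` H" "a' h = x" and eq: "\<And>g. g \<in> H \<Longrightarrow> a' g = a g"
    using insert.hyps by (auto simp: a'_def image_def)
  have "inj_on a' H" using a(2) eq by (metis inj_on_cong)
  then have "inj_on a' (insert h H)" using a(3) im insert.hyps by auto
  moreover have "D \<union> a' ` insert h H = insert x D \<union> a ` H" using im by simp
  ultimately show ?case
    using a x xD' im eq by (intro exI[of _ a']) auto
qed

text \<open>One functional has to serve all of \<open>M\<close> at once. To include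
  \<open>b\<close>, a multiple \<open>t\<close> of a functional \<theta> with value 1 at
  \<open>b\<close> is added to \<psi>. Each member of \<open>insert b M\<close> excludes at most one
  \<open>t\<close>, as \<psi> or \<theta> is nonzero there.\<close>

lemma functional_separating:
  fixes D :: "'b::real_vector set"
  assumes "finite M" "\<And>b. b \<in> M \<Longrightarrow> b \<notin> span D"
  shows "\<exists>\<psi>::'b \<Rightarrow> real. linear \<psi> \<and> (\<forall>x\<in>span D. \<psi> x = 0) \<and> (\<forall>b\<in>M. \<psi> b \<noteq> 0)"
  using assms
proof (induction M)
  case empty
  have "linear (\<lambda>x::'b. 0::real)" by (simp add: linear_iff)
  then show ?case by (intro exI[of _ "\<lambda>x. 0"]) auto
next
  case (insert b M)
  then obtain \<psi> :: "'b \<Rightarrow> real" where \<psi>: "linear \<psi>" "\<forall>x\<in>span D. \<psi> x = 0" "\<forall>b\<in>M. \<psi> b \<noteq> 0" by auto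
  obtain C where C: "C \<subseteq> D" "independent C" "span C = span D"
    using maximal_independent_subset[of D] by (metis span_mono span_span subset_antisym)
  have "b \<notin> span C" using C(3) insert.prems by blast
  then have "independent (insert b C)" by (rule independent_insertI[OF _ C(2)])
  from linear_independent_extend[OF this, of "\<lambda>x. if x = b then 1 else 0"]
  obtain \<theta> :: "'b \<Rightarrow> real" where \<theta>: "linear \<theta>" "\<forall>x\<in>insert b C. \<theta> x = (if x = b then 1 else 0)" by blast
  have bC: "b \<notin> C" using C insert.prems span_superset by blast
  have \<theta>C: "\<theta> x = 0" if "x \<in> C" for x using \<theta>(2) bC that by auto
  have \<theta>0: "\<theta> x = 0" if "x \<in> span D" for x
    using linear_eq_0_on_span[OF \<theta>(1) \<theta>C] that C(3) by blast
  have "finite (\<Union>m\<in>insert b M. {t. \<psi> m + t * \<theta> m = 0 \<and> \<not> (\<psi> m = 0 \<and> \<theta> m = 0)})"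
  proof (rule finite_UN_I)
    fix m
    have "t = - \<psi> m / \<theta> m" if "\<psi> m + t * \<theta> m = 0" "\<not> (\<psi> m = 0 \<and> \<theta> m = 0)" for t
    proof -
      have "t * \<theta> m = - \<psi> m" "\<theta> m \<noteq> 0" using that by auto
      then show ?thesis by (metis nonzero_mult_div_cancel_right)
    qed
    then have "{t. \<psi> m + t * \<theta> m = 0 \<and> \<not> (\<psi> m = 0 \<and> \<theta> m = 0)} \<subseteq> {- \<psi> m / \<theta> m}" by blast
    then show "finite {t. \<psi> m + t * \<theta> m = 0 \<and> \<not> (\<psi> m = 0 \<and> \<theta> m = 0)}" using finite_subset by blast
  qed (use insert.hyps in simp)
  from ex_new_if_finite[OF infinite_UNIV_char_0 this]
  obtain t where "t \<notin> (\<Union>m\<in>insert b M. {t. \<psi> m + t * \<theta> m = 0 \<and> \<not> (\<psi> m = 0 \<and> \<theta> m = 0)})"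
    by blast
  then have t: "\<psi> m = 0 \<and> \<theta> m = 0 \<or> \<psi> m + t * \<theta> m \<noteq> 0" if "m \<in> insert b M" for m
    using that by blast
  have "linear (\<lambda>x. \<psi> x + t * \<theta> x)"
    using \<psi>(1) \<theta>(1) by (simp add: linear_iff algebra_simps)
  moreover have "\<psi> m + t * \<theta> m \<noteq> 0" if "m \<in> insert b M" for m
    using t[OF that] that \<psi>(3) \<theta>(2) by auto
  ultimately show ?case using \<psi>(2) \<theta>0 by (intro exI[of _ "\<lambda>x. \<psi> x + t * \<theta> x"]) auto
qed

section \<open>Generic point configurations\<close>

lemma lookup_scaleR:
  "Poly_Mapping.lookup (c *\<^sub>R f) v = c *\<^sub>R Poly_Mapping.lookup (f :: 'v \<Rightarrow>\<^sub>0 'b::real_vector) v"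
proof -
  have "{i. c *\<^sub>R Poly_Mapping.lookup f i \<noteq> 0} \<subseteq> {i. Poly_Mapping.lookup f i \<noteq> 0}" by auto
  then have "finite {i. c *\<^sub>R Poly_Mapping.lookup f i \<noteq> 0}" by (rule finite_subset) simp
  then show ?thesis by (simp add: scaleR_poly_mapping_def)
qed

lemma linear_single: "linear (Poly_Mapping.single v :: 'b::real_vector \<Rightarrow> 'v \<Rightarrow>\<^sub>0 'b)"
  by (rule linearI) (auto simp: single_add lookup_scaleR lookup_single when_def intro!: poly_mapping_eqI)

text \<open>Paired with a configuration \<open>q\<close> it gives x \<bullet> (q u - q v), so it is
  a row of the parallel redrawing matrix. Finitely supported functions serve as the direct sum of
  one copy of the space per vertex.\<close>

definition edge_vec :: "'v \<Rightarrow> 'v \<Rightarrow> 'b::real_vector \<Rightarrow> 'v \<Rightarrow>\<^sub>0 'b"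
  where "edge_vec u v x = Poly_Mapping.single u x - Poly_Mapping.single v x"

lemma linear_edge_vec: "linear (edge_vec u v)"
  unfolding edge_vec_def by (rule linear_compose_sub[OF linear_single linear_single])

text \<open>The axis \<open>k\<close> is left out because the normals vary in dimension n - 1;
  \<open>k\<close> becomes the coordinate in which \<open>p v = (q v, 1)\<close> has the entry 1.
  Taking all pairs from \<open>e\<close> avoids an orientation and adds only negatives and 0 to the
  generators.\<close>

definition edge_gens :: "'n \<Rightarrow> 'v set \<Rightarrow> ('v \<Rightarrow>\<^sub>0 real^'n) set"
  where "edge_gens k e = (\<lambda>(u, v, j). edge_vec u v (axis j 1)) ` (e \<times> e \<times> - {k})"

lemma finite_edge_gens: "finite e \<Longrightarrow> finite (edge_gens k e)"
  by (simp add: edge_gens_def)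

lemma span_edge_gens:
  assumes "y \<in> span (edge_gens k {u, v})"
  shows "\<exists>x. x $ k = 0 \<and> y = edge_vec u v x"
proof -
  have "edge_gens k {u, v} \<subseteq> edge_vec u v ` {x. x $ k = 0}"
  proof
    fix z assume "z \<in> edge_gens k {u, v}"
    then obtain u' v' j where z: "z = edge_vec u' v' (axis j 1)" "u' \<in> {u, v}" "v' \<in> {u, v}" "j \<noteq> k"
      by (auto simp: edge_gens_def)
    have "z \<in> {edge_vec u v 0, edge_vec u v (axis j 1), edge_vec u v (- axis j 1)}"
      using z by (auto simp: edge_vec_def single_uminus)
    then show "z \<in> edge_vec u v ` {x. x $ k = 0}"
      using z(4) by (auto simp: axis_def)
  qed
  moreover have "subspace (edge_vec u v ` {x. x $ k = 0})"
    by (rule linear_subspace_image[OF linear_edge_vec]) (simp add: subspace_def)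
  ultimately show ?thesis using assms span_minimal by blast
qed

text \<open>The vertices fall into classes tied together by the equations of \<open>E'\<close>. A
  class \<open>C\<close> contributes (n - 1) (card C - 1) independent differences to a root. By
  sparsity this is at least n - 2 per edge inside \<open>C\<close>, plus 1 if there is such an edge.
  Every edge of \<open>E'\<close> lies in one class, and since \<open>E'\<close> is nonempty the 1
  is gained at least once.\<close>

lemma incidence_rank:
  fixes k :: "'n::finite" and V :: "'v set"
  assumes "simple_graph V E" and n: "3 \<le> CARD('n)"
    and sparse: "\<And>W. W \<subseteq> V \<Longrightarrow> 2 \<le> card W \<Longrightarrow>
      (CARD('n) - 2) * card {e \<in> E. e \<subseteq> W} + CARD('n) \<le> (CARD('n) - 1) * card W"
    and E': "E' \<subseteq> E" "E' \<noteq> {}"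
  shows "\<exists>B. finite B \<and> independent B \<and> B \<subseteq> span (\<Union>e\<in>E'. edge_gens k e) \<and>
    (CARD('n) - 2) * card E' + 1 \<le> card B"
proof -
  have V: "finite V" and E: "\<And>e. e \<in> E \<Longrightarrow> e \<subseteq> V \<and> card e = 2"
    using assms(1) by (auto simp: simple_graph_def)
  define X where "X = span (\<Union>e\<in>E'. edge_gens k e)"
  \<comment> \<open>Related vertices are those whose points must agree off the coordinate
    \<open>k\<close> once all equations in \<open>X\<close> hold. This yields the components of
    \<open>E'\<close> without paths: transitivity is addition in \<open>X\<close>.\<close>
  define R where "R = {(u, v). u \<in> V \<and> v \<in> V \<and> (\<forall>j\<in>-{k}. edge_vec u v (axis j 1) \<in> X)}"
  have sX: "subspace X" by (simp add: X_def)
  have eqR: "equiv V R"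
  proof (rule equivI)
    show "R \<subseteq> V \<times> V" by (auto simp: R_def)
    show "refl_on V R" using subspace_0[OF sX] by (auto simp: refl_on_def R_def edge_vec_def)
    show "sym R"
    proof (rule symI)
      fix u v assume uv: "(u, v) \<in> R"
      have "edge_vec v u (axis j 1) = - edge_vec u v (axis j (1::real))" for j :: 'n
        by (simp add: edge_vec_def)
      then show "(v, u) \<in> R" using uv subspace_neg[OF sX] by (auto simp: R_def)
    qed
    show "trans R"
    proof (rule transI)
      fix u v w assume uv: "(u, v) \<in> R" "(v, w) \<in> R"
      have "edge_vec u w (axis j 1) = edge_vec u v (axis j 1) + edge_vec v w (axis j (1::real))" for j :: 'n
        by (simp add: edge_vec_def)
      then show "(u, w) \<in> R" using uv subspace_add[OF sX] by (auto simp: R_def)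
    qed
  qed
  define Q where "Q = V // R"
  have QV: "\<Union>Q = V" and finQ: "finite Q" and Qsub: "\<And>C. C \<in> Q \<Longrightarrow> C \<subseteq> V \<and> C \<noteq> {} \<and> finite C"
    using Union_quotient[OF eqR] finite_quotient[OF V, of R] V in_quotient_imp_subset[OF eqR]
      in_quotient_imp_non_empty[OF eqR] finite_subset[OF _ V] eqR
    by (auto simp: Q_def equiv_def)
  have Qdisj: "C = C' \<or> C \<inter> C' = {}" if "C \<in> Q" "C' \<in> Q" for C C'
    using quotient_disj[OF eqR] that by (simp add: Q_def)
  define \<rho> where "\<rho> = (\<lambda>C :: 'v set. SOME v. v \<in> C)"
  have \<rho>: "\<rho> C \<in> C" if "C \<in> Q" for C using Qsub[OF that] by (simp add: \<rho>_def some_in_eq)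
  define r where "r = (\<lambda>v. \<rho> (R `` {v}))"
  have r: "r v = \<rho> C" if "C \<in> Q" "v \<in> C" for v C
    using that quotient_eq_iff[OF eqR] equiv_class_eq_iff[OF eqR] Qsub
    by (metis Image_singleton_iff Q_def eqR equiv_class_eq quotientE r_def)
  define N0 where "N0 = {v \<in> V. r v \<noteq> v}"
  have rr: "r v \<in> V \<and> r (r v) = r v \<and> (v, r v) \<in> R" if v: "v \<in> V" for v
  proof -
    obtain C where C: "C \<in> Q" "v \<in> C" using v QV by blast
    then have "r v = \<rho> C" "\<rho> C \<in> C" using r \<rho> by auto
    moreover have "(v, \<rho> C) \<in> R"
      using quotient_eq_iff[OF eqR, of C C v "\<rho> C"] C \<rho>[OF C(1)] by (simp add: Q_def)
    ultimately show ?thesis using r[OF C(1)] Qsub C by auto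
  qed
  have N0: "N0 = (\<Union>C\<in>Q. C - {\<rho> C})"
    unfolding N0_def using QV r by auto
  have cardN0: "card N0 = (\<Sum>C\<in>Q. card C - 1)"
    unfolding N0 using finQ Qsub Qdisj \<rho> by (subst card_UN_disjoint) (auto simp: card_Diff_singleton)
  define b where "b = (\<lambda>(v, j :: 'n). edge_vec v (r v) (axis j (1::real)))"
  have ind: "inj_on b (N0 \<times> - {k}) \<and> independent (b ` (N0 \<times> - {k}))"
  proof (rule independent_family)
    show fin: "finite (N0 \<times> - {k})" using V by (simp add: N0_def)
    fix c assume c: "(\<Sum>i\<in>N0 \<times> - {k}. c i *\<^sub>R b i) = 0"
    show "\<forall>i\<in>N0 \<times> - {k}. c i = 0"
    proof
      fix i assume i: "i \<in> N0 \<times> - {k}"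
      obtain v j where ij: "i = (v, j)" by (cases i)
      \<comment> \<open>Here \<open>v\<close> is not a root, whereas every \<open>r v'\<close> is
        one. So the entry at \<open>v\<close> and \<open>j\<close> is nonzero only in
        \<open>b (v, j)\<close> and reads off a single coefficient.\<close>
      have "Poly_Mapping.lookup (b l) v $ j = (if l = i then 1 else 0)" if l: "l \<in> N0 \<times> - {k}" for l
      proof -
        obtain v' j' where l': "l = (v', j')" by (cases l)
        have "r v' \<noteq> v" using rr[of v'] l l' i ij by (auto simp: N0_def)
        then show ?thesis
          by (auto simp: b_def l' ij edge_vec_def lookup_minus lookup_single when_def axis_def)
      qed
      then have "(\<Sum>l\<in>N0 \<times> - {k}. c l * Poly_Mapping.lookup (b l) v $ j) =
          (\<Sum>l\<in>N0 \<times> - {k}. if l = i then c l else 0)"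
        by (intro sum.cong refl) (simp only: mult_1_right mult_zero_right split: if_split, simp)
      then have "Poly_Mapping.lookup (\<Sum>i\<in>N0 \<times> - {k}. c i *\<^sub>R b i) v $ j =
          (\<Sum>l\<in>N0 \<times> - {k}. if l = i then c l else 0)"
        by (simp only: lookup_sum lookup_scaleR sum_component vector_scaleR_component real_scaleR_def)
      also have "\<dots> = c i" using fin i by simp
      finally show "c i = 0" using c by simp
    qed
  qed
  have inX: "b ` (N0 \<times> - {k}) \<subseteq> X" using rr by (auto simp: b_def N0_def R_def)
  have card1: "card (b ` (N0 \<times> - {k})) = (CARD('n) - 1) * (\<Sum>C\<in>Q. card C - 1)"
    using ind by (simp add: card_image card_cartesian_product cardN0 Compl_eq_Diff_UNIV)
  define m where "m = (\<lambda>C. card {e \<in> E'. e \<subseteq> C})"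
  have "E \<subseteq> Pow V" using E by auto
  then have finEE: "finite E" using V finite_subset by blast
  then have finE: "finite E'" using E'(1) finite_subset by blast
  have edge_class: "\<exists>C\<in>Q. e \<subseteq> C" if e: "e \<in> E'" for e
  proof -
    obtain u v where uv: "e = {u, v}" using E E'(1) e by (meson card_2_iff subsetD)
    have "edge_vec u v (axis j 1) \<in> X" if "j \<noteq> k" for j
    proof -
      have "edge_vec u v (axis j 1) \<in> edge_gens k e"
        unfolding edge_gens_def uv using that by (intro image_eqI[of _ _ "(u, v, j)"]) auto
      then show ?thesis unfolding X_def using e by (blast intro: span_base)
    qed
    then have "(u, v) \<in> R" using uv e E E'(1) by (auto simp: R_def)
    then have "{u, v} \<subseteq> R `` {u}" using eqR uv e E E'(1) by (auto simp: equiv_def refl_on_def)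
    moreover have "u \<in> V" using uv e E E'(1) by blast
    then have "R `` {u} \<in> Q" unfolding Q_def by (rule quotientI)
    ultimately show ?thesis using uv by blast
  qed
  \<comment> \<open>For two or more vertices this is sparsity with n split as (n - 1) + 1. The
    summand 1 is dropped for classes without edges, since for a singleton the right side is
    0.\<close>
  have mle: "(CARD('n) - 2) * m C + (if m C = 0 then 0 else 1) \<le> (CARD('n) - 1) * (card C - 1)"
    if C: "C \<in> Q" for C
  proof (cases "2 \<le> card C")
    case True
    have "m C \<le> card {e \<in> E. e \<subseteq> C}"
      unfolding m_def using E'(1) finEE by (intro card_mono) auto
    then have "(CARD('n) - 2) * m C + CARD('n) \<le> (CARD('n) - 1) * card C"
      using sparse[of C] Qsub[OF C] True by (meson add_le_mono1 mult_le_mono2 le_trans)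
    also have "\<dots> = (CARD('n) - 1) * (card C - 1) + (CARD('n) - 1)"
      using True by (metis One_nat_def Suc_pred add.commute less_le_trans mult_Suc_right pos2)
    finally show ?thesis using n by auto
  next
    case False
    have "{e \<in> E'. e \<subseteq> C} = {}"
      using False E E'(1) Qsub[OF C] card_mono by (metis (no_types, lifting) Collect_empty_eq subsetD)
    then have "m C = 0" unfolding m_def by (metis card.empty)
    then show ?thesis by simp
  qed
  obtain e0 C0 where e0: "e0 \<in> E'" "C0 \<in> Q" "e0 \<subseteq> C0" using E'(2) edge_class by blast
  then have m0: "m C0 \<noteq> 0" using finE by (auto simp: m_def)
  have "card E' \<le> card (\<Union>C\<in>Q. {e \<in> E'. e \<subseteq> C})"
    using edge_class finE by (intro card_mono) (auto intro: finite_subset[of _ E'])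
  also have "\<dots> \<le> (\<Sum>C\<in>Q. m C)" unfolding m_def by (rule card_UN_le[OF finQ])
  finally have "(CARD('n) - 2) * card E' + 1 \<le> (\<Sum>C\<in>Q. (CARD('n) - 2) * m C) + 1"
    by (simp add: sum_distrib_left[symmetric])
  also have "1 \<le> (\<Sum>C\<in>Q. if m C = 0 then 0 else 1 :: nat)"
    using member_le_sum[of C0 Q "\<lambda>C. if m C = 0 then 0 else 1 :: nat"] e0 m0 finQ by simp
  then have "(\<Sum>C\<in>Q. (CARD('n) - 2) * m C) + 1 \<le>
      (\<Sum>C\<in>Q. (CARD('n) - 2) * m C + (if m C = 0 then 0 else 1))"
    by (simp add: sum.distrib)
  also have "\<dots> \<le> (\<Sum>C\<in>Q. (CARD('n) - 1) * (card C - 1))" by (rule sum_mono[OF mle])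
  finally have "(CARD('n) - 2) * card E' + 1 \<le> card (b ` (N0 \<times> - {k}))"
    by (simp add: card1 sum_distrib_left)
  then show ?thesis
    using ind inX V by (intro exI[of _ "b ` (N0 \<times> - {k})"]) (auto simp: X_def N0_def)
qed

section \<open>Stresses and the construction of a configuration without stress\<close>

definition stress_free :: "'v set \<Rightarrow> 'v set set \<Rightarrow> ('v \<Rightarrow> 'b::real_inner set) \<Rightarrow> bool"
  where "stress_free V E T \<longleftrightarrow> (\<forall>f.
    (\<forall>e\<in>E. \<forall>v\<in>e. \<forall>x\<in>T v. f v e \<bullet> x = 0) \<and>
    (\<forall>v\<in>V. (\<Sum>e\<in>{e\<in>E. v \<in> e}. f v e) = 0) \<and> (\<forall>e\<in>E. (\<Sum>v\<in>e. f v e) = 0) \<longrightarrow>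
    (\<forall>e\<in>E. \<forall>v\<in>e. f v e = 0))"

text \<open>Double counting of incidences. For a family that is balanced over every edge it
  identifies a linear relation between the edge equations with balance at every vertex, and it is
  used in both directions of the main equivalence.\<close>

lemma sum_edge_vec:
  fixes g :: "'v \<Rightarrow> 'v set \<Rightarrow> 'b::real_vector"
  assumes "finite V" "finite E" "\<And>e. e \<in> E \<Longrightarrow> e \<subseteq> V \<and> e = {s e, t e} \<and> s e \<noteq> t e \<and> g (t e) e = - g (s e) e"
  shows "(\<Sum>e\<in>E. edge_vec (s e) (t e) (g (s e) e)) =
    (\<Sum>v\<in>V. Poly_Mapping.single v (\<Sum>e\<in>{e\<in>E. v \<in> e}. g v e))"
proof -
  have "edge_vec (s e) (t e) (g (s e) e) = (\<Sum>v\<in>{v\<in>V. v \<in> e}. Poly_Mapping.single v (g v e))"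
    if e: "e \<in> E" for e
  proof -
    have "{v\<in>V. v \<in> e} = {s e, t e}" "s e \<noteq> t e" "g (t e) e = - g (s e) e"
      using assms(3)[OF e] by auto
    then show ?thesis by (simp add: edge_vec_def single_uminus)
  qed
  then have "(\<Sum>e\<in>E. edge_vec (s e) (t e) (g (s e) e)) =
      (\<Sum>e\<in>E. \<Sum>v\<in>{v\<in>V. v \<in> e}. Poly_Mapping.single v (g v e))" by simp
  also have "\<dots> = (\<Sum>v\<in>V. \<Sum>e\<in>{e\<in>E. v \<in> e}. Poly_Mapping.single v (g v e))"
    by (rule sum.swap_restrict[OF assms(2,1)])
  also have "\<dots> = (\<Sum>v\<in>V. Poly_Mapping.single v (\<Sum>e\<in>{e\<in>E. v \<in> e}. g v e))"
    by (simp add: linear_sum[OF linear_single])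
  finally show ?thesis .
qed

lemma oriented_edges:
  assumes "simple_graph V E"
  obtains s t where "\<And>e. e \<in> E \<Longrightarrow> e = {s e, t e} \<and> s e \<noteq> t e"
proof -
  have "\<forall>e\<in>E. \<exists>p. e = {fst p, snd p} \<and> fst p \<noteq> snd p"
    using assms by (auto simp: simple_graph_def card_2_iff)
  then obtain p where "\<forall>e\<in>E. e = {fst (p e), snd (p e)} \<and> fst (p e) \<noteq> snd (p e)"
    by (metis bchoice)
  then show ?thesis using that[of "fst \<circ> p" "snd \<circ> p"] by simp
qed

text \<open>
  Take generic normals \<open>x (e, i)\<close>, \<open>i < n - 2\<close>, for every edge such that the equations
  \<open>x (e, i) \<bullet> (q u - q v) = 0\<close> are independent and do not force the two ends of any edge to coincide.
  At a solution \<open>q\<close> with distinct ends the normals of \<open>e\<close> span the orthogonal complement of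
  \<open>q u - q v\<close>, so that a stress at \<open>q\<close> is a linear relation between the equations.
\<close>

lemma exists_stress_free:
  fixes V :: "'v set"
  assumes G: "simple_graph V E" and n: "3 \<le> CARD('n::finite)"
    and sparse: "\<And>W. W \<subseteq> V \<Longrightarrow> 2 \<le> card W \<Longrightarrow>
      (CARD('n) - 2) * card {e \<in> E. e \<subseteq> W} + CARD('n) \<le> (CARD('n) - 1) * card W"
  shows "\<exists>p :: 'v \<Rightarrow> real^'n. (\<forall>v. p v \<noteq> 0) \<and> stress_free V E (\<lambda>v. span {p v})"
proof -
  \<comment> \<open>An arbitrary coordinate, reserved for the entry 1 of the homogeneous
    coordinates.\<close>
  define k :: 'n where "k = undefined"
  have V: "finite V" and E: "\<And>e. e \<in> E \<Longrightarrow> e \<subseteq> V \<and> card e = 2"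
    using G by (auto simp: simple_graph_def)
  have "E \<subseteq> Pow V" using E by auto
  then have finE: "finite E" using V finite_subset by blast
  have fine: "finite e" if "e \<in> E" for e using E[OF that] V finite_subset by blast
  obtain s t where st: "\<And>e. e \<in> E \<Longrightarrow> e = {s e, t e} \<and> s e \<noteq> t e"
    using oriented_edges[OF G] by blast
  define H where "H = E \<times> {..<CARD('n) - 2}"
  define A where "A = (\<lambda>h :: 'v set \<times> nat. edge_gens k (fst h))"
  have finH: "finite H" using finE by (simp add: H_def)
  have "\<exists>a. (\<forall>h\<in>H. a h \<in> span (A h)) \<and> inj_on a H \<and> a ` H \<inter> {} = {} \<and>
    independent ({} \<union> a ` H) \<and> (\<forall>f\<in>H. \<not> A f \<subseteq> span ({} \<union> a ` H))"
  proof (rule generic_transversal[OF finH finH])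
    fix F f assume F: "F \<subseteq> H" and f: "f \<in> H"
    \<comment> \<open>The edge of \<open>f\<close> is included, so that the span in question is the
      one of \<open>E'\<close>. As \<open>F\<close> has at most n - 2 members per edge of
      \<open>E'\<close>, the spare 1 of \<open>incidence_rank\<close> is the one demanded
      here.\<close>
    define E' where "E' = insert (fst f) (fst ` F)"
    have E': "E' \<subseteq> E" "E' \<noteq> {}" using F f by (auto simp: E'_def H_def)
    obtain B where B: "finite B" "independent B" "B \<subseteq> span (\<Union>e\<in>E'. edge_gens k e)"
      "(CARD('n) - 2) * card E' + 1 \<le> card B"
      using incidence_rank[where k = k, OF G n sparse E'] by blast
    have "F \<subseteq> E' \<times> {..<CARD('n) - 2}"
    proof
      fix h assume "h \<in> F"
      then show "h \<in> E' \<times> {..<CARD('n) - 2}" using F by (cases h) (force simp: E'_def H_def)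
    qed
    then have "card F \<le> card (E' \<times> {..<CARD('n) - 2})"
      using finite_subset[OF E'(1) finE] by (intro card_mono) auto
    then have "card F \<le> (CARD('n) - 2) * card E'" by (simp add: card_cartesian_product mult.commute)
    moreover have "(\<Union>e\<in>E'. edge_gens k e) = {} \<union> A f \<union> \<Union>(A ` F)" by (auto simp: E'_def A_def)
    ultimately show "\<exists>B. finite B \<and> independent B \<and> B \<subseteq> span ({} \<union> A f \<union> \<Union>(A ` F)) \<and>
        card F + 1 + card {} \<le> card B"
      using B by (intro exI[of _ B]) auto
  qed (use fine in \<open>auto simp: A_def H_def independent_empty intro!: finite_edge_gens\<close>)
  then obtain a where a: "\<And>h. h \<in> H \<Longrightarrow> a h \<in> span (A h)" "inj_on a H" "independent (a ` H)"
    "\<And>f. f \<in> H \<Longrightarrow> \<not> A f \<subseteq> span (a ` H)" by auto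
  have "\<exists>x. x $ k = 0 \<and> a h = edge_vec (s (fst h)) (t (fst h)) x" if "h \<in> H" for h
    using span_edge_gens[of "a h" k "s (fst h)" "t (fst h)"] a(1)[OF that] st[of "fst h"] that
    by (auto simp: A_def H_def)
  then obtain x where x: "\<And>h. h \<in> H \<Longrightarrow> x h $ k = 0 \<and> a h = edge_vec (s (fst h)) (t (fst h)) (x h)"
    by metis
  \<comment> \<open>For every edge some difference of coordinates is not forced to vanish by the
    chosen equations. The index 0 is legitimate because n - 2 is positive.\<close>
  have "\<exists>y\<in>edge_gens k e. y \<notin> span (a ` H)" if "e \<in> E" for e
    using a(4)[of "(e, 0)"] that n by (auto simp: A_def H_def)
  then obtain m where m: "\<And>e. e \<in> E \<Longrightarrow> m e \<in> edge_gens k e \<and> m e \<notin> span (a ` H)" by metis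
  \<comment> \<open>A functional that vanishes on the equations is a configuration satisfying them.
    Being nonzero at all \<open>m e\<close> simultaneously, it keeps the ends of all edges
    distinct.\<close>
  have "\<exists>\<psi>::('v \<Rightarrow>\<^sub>0 real^'n) \<Rightarrow> real. linear \<psi> \<and> (\<forall>y\<in>span (a ` H). \<psi> y = 0) \<and> (\<forall>b\<in>m ` E. \<psi> b \<noteq> 0)"
    using m finE by (intro functional_separating) auto
  then obtain \<psi> :: "('v \<Rightarrow>\<^sub>0 real^'n) \<Rightarrow> real"
    where \<psi>: "linear \<psi>" "\<And>y. y \<in> span (a ` H) \<Longrightarrow> \<psi> y = 0" "\<And>e. e \<in> E \<Longrightarrow> \<psi> (m e) \<noteq> 0"
    by auto
  define q :: "'v \<Rightarrow> real^'n"
    where "q = (\<lambda>v. \<chi> j. if j = k then 0 else \<psi> (Poly_Mapping.single v (axis j 1)))"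
  have q: "\<psi> (Poly_Mapping.single v y) = q v \<bullet> y" if "y $ k = 0" for v y
  proof -
    have lin: "linear (\<lambda>y. \<psi> (Poly_Mapping.single v y))"
      using linear_compose[OF linear_single \<psi>(1)] by (simp add: o_def)
    have "y = (\<Sum>j\<in>UNIV. (y $ j) *\<^sub>R axis j 1)" by (simp add: basis_expansion flip: scalar_mult_eq_scaleR)
    then have "\<psi> (Poly_Mapping.single v y) = \<psi> (Poly_Mapping.single v (\<Sum>j\<in>UNIV. (y $ j) *\<^sub>R axis j 1))"
      by simp
    also have "\<dots> = (\<Sum>j\<in>UNIV. (y $ j) * \<psi> (Poly_Mapping.single v (axis j 1)))"
      by (simp add: linear_sum[OF lin] linear_scale[OF lin])
    also have "\<dots> = q v \<bullet> y"
      unfolding inner_vec_def by (rule sum.cong) (auto simp: q_def that)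
    finally show ?thesis .
  qed
  have qk: "q v $ k = 0" for v by (simp add: q_def)
  have qedge: "\<psi> (edge_vec u v y) = (q u - q v) \<bullet> y" if "y $ k = 0" for u v y
    using that by (simp add: edge_vec_def linear_diff[OF \<psi>(1)] q inner_diff_left)
  have qne: "q (s e) \<noteq> q (t e)" if e: "e \<in> E" for e
  proof
    assume eq: "q (s e) = q (t e)"
    obtain u v j where uv: "u \<in> e" "v \<in> e" "j \<noteq> k" "m e = edge_vec u v (axis j 1)"
      using m[OF e] by (auto simp: edge_gens_def)
    then have "u \<in> {s e, t e}" "v \<in> {s e, t e}" using st[OF e] by blast+
    then have "q u = q v" using eq by auto
    moreover have "\<psi> (m e) = (q u - q v) \<bullet> axis j 1"
      using qedge[of "axis j 1"] uv by (auto simp: axis_def)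
    ultimately show False using \<psi>(3)[OF e] by simp
  qed
  define p where "p = (\<lambda>v. q v + axis k 1)"
  have pk: "p v $ k = 1" for v by (simp add: p_def qk axis_def)
  have "stress_free V E (\<lambda>v. span {p v})"
    unfolding stress_free_def
  proof (intro allI impI, elim conjE)
    fix f :: "'v \<Rightarrow> 'v set \<Rightarrow> real^'n"
    assume "\<forall>e\<in>E. \<forall>v\<in>e. \<forall>x\<in>span {p v}. f v e \<bullet> x = 0"
    then have orth: "\<And>e v. e \<in> E \<Longrightarrow> v \<in> e \<Longrightarrow> f v e \<bullet> p v = 0" using span_base by fastforce
    assume bal: "\<forall>v\<in>V. (\<Sum>e\<in>{e\<in>E. v \<in> e}. f v e) = 0" and "\<forall>e\<in>E. (\<Sum>v\<in>e. f v e) = 0"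
    then have neg: "f (t e) e = - f (s e) e" if "e \<in> E" for e
      using st[OF that] that by (metis (no_types, lifting) add.commute add_eq_0_iff finite.emptyI
          finite.insertI insert_absorb insert_not_empty singletonD sum.empty sum.insert add_0_right)
    \<comment> \<open>Dropping the coordinate \<open>k\<close> leaves every product with a
      difference \<open>q u - q v\<close> unchanged, as such a difference has entry 0 there. So
      orthogonality to both \<open>p (s e)\<close> and \<open>p (t e)\<close> becomes orthogonality
      of \<open>g e\<close> to the direction of the edge.\<close>
    define pr where "pr = (\<lambda>y :: real^'n. y - (y $ k) *\<^sub>R axis k 1)"
    have lin: "linear pr" by (rule linearI) (auto simp: pr_def algebra_simps)
    have prk: "pr y $ k = 0" for y by (simp add: pr_def axis_def)
    have prq: "pr y \<bullet> (q u - q v) = y \<bullet> (q u - q v)" for y u v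
      by (simp add: pr_def inner_diff_left inner_axis' qk)
    define g where "g = (\<lambda>e. pr (f (s e) e))"
    have gw: "g e \<bullet> (q (s e) - q (t e)) = 0" if e: "e \<in> E" for e
    proof -
      have "f (s e) e \<bullet> p (s e) = 0" "f (s e) e \<bullet> p (t e) = 0"
        using orth[OF e, of "s e"] orth[OF e, of "t e"] st[OF e] neg[OF e] by auto
      then show ?thesis unfolding g_def prq by (simp add: p_def inner_diff_right inner_add_right)
    qed
    have rel: "c (e, i) = 0"
      if e: "e \<in> E" and c: "(\<Sum>i<CARD('n) - 2. c (e, i) *\<^sub>R x (e, i)) = 0" and i: "i < CARD('n) - 2"
      for e i and c :: "'v set \<times> nat \<Rightarrow> real"
    proof -
      have "(\<Sum>h\<in>{e} \<times> {..<CARD('n) - 2}. c h *\<^sub>R a h) =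
          (\<Sum>i<CARD('n) - 2. c (e, i) *\<^sub>R edge_vec (s e) (t e) (x (e, i)))"
        using x e by (simp add: sum.cartesian_product' H_def)
      also have "\<dots> = edge_vec (s e) (t e) (\<Sum>i<CARD('n) - 2. c (e, i) *\<^sub>R x (e, i))"
        by (simp add: linear_sum[OF linear_edge_vec] linear_scale[OF linear_edge_vec])
      also have "\<dots> = 0" by (simp add: c linear_0[OF linear_edge_vec])
      finally have z: "(\<Sum>h\<in>{e} \<times> {..<CARD('n) - 2}. c h *\<^sub>R a h) = 0" .
      have sub: "{e} \<times> {..<CARD('n) - 2} \<subseteq> H" using e by (auto simp: H_def)
      show ?thesis
        by (rule independent_family_rel[OF _ inj_on_subset[OF a(2) sub]
              independent_mono[OF a(3) image_mono[OF sub]] z]) (use i in auto)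
    qed
    have gspan: "\<exists>c. g e = (\<Sum>i<CARD('n) - 2. c i *\<^sub>R x (e, i))" if e: "e \<in> E" for e
    proof -
      define Xs where "Xs = (\<lambda>i. x (e, i)) ` {..<CARD('n) - 2}"
      define w where "w = q (s e) - q (t e)"
      have ind: "inj_on (\<lambda>i. x (e, i)) {..<CARD('n) - 2} \<and> independent Xs"
        unfolding Xs_def
      proof (rule independent_family, safe)
        fix c i assume "(\<Sum>i<CARD('n) - 2. c i *\<^sub>R x (e, i)) = 0" "i < CARD('n) - 2"
        then show "c i = 0" using rel[OF e, of "c \<circ> snd" i] by simp
      qed
      have hH: "(e, i) \<in> H" if "i < CARD('n) - 2" for i using that e by (simp add: H_def)
      have xw: "y \<bullet> w = 0 \<and> y $ k = 0" if y: "y \<in> Xs" for y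
      proof -
        obtain i where i: "i < CARD('n) - 2" "y = x (e, i)" using y by (auto simp: Xs_def)
        have "\<psi> (a (e, i)) = 0" using \<psi>(2) hH[OF i(1)] by (simp add: span_base)
        then show ?thesis using x[OF hH[OF i(1)]] qedge[of "x (e, i)" "s e" "t e"] i(2)
          by (simp add: w_def inner_commute)
      qed
      \<comment> \<open>\<open>Xs\<close> consists of n - 2 independent vectors orthogonal both to
        \<open>w\<close> and to the axis \<open>k\<close>. A further such vector \<open>g e\<close>,
        together with \<open>w\<close> and \<open>axis k 1\<close>, would give n + 1 independent
        vectors in dimension n.\<close>
      have "g e \<in> span Xs"
      proof (rule ccontr)
        assume ng: "g e \<notin> span Xs"
        have sub1: "span (insert (g e) Xs) \<subseteq> {y. y \<bullet> w = 0}"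
          using xw gw[OF e] by (intro span_minimal) (auto simp: w_def subspace_def inner_add_left)
        have w0: "w \<noteq> 0" using qne[OF e] by (simp add: w_def)
        then have nw: "w \<notin> span (insert (g e) Xs)" using sub1 by auto
        have sub2: "span (insert w (insert (g e) Xs)) \<subseteq> {y. y $ k = 0}"
          using xw prk by (intro span_minimal) (auto simp: w_def g_def qk subspace_def)
        have na: "axis k 1 \<notin> span (insert w (insert (g e) Xs))"
          using sub2 by (auto simp: axis_def)
        have "independent (insert (axis k 1) (insert w (insert (g e) Xs)))"
          using ind by (intro independent_insertI[OF na] independent_insertI[OF nw] independent_insertI[OF ng]) simp
        from independent_bound[OF this]
        have "card (insert (axis k 1) (insert w (insert (g e) Xs))) \<le> CARD('n)"
          by simp
        moreover have "axis k 1 \<notin> insert w (insert (g e) Xs)" "w \<notin> insert (g e) Xs" "g e \<notin> Xs"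
          using na nw ng by (metis span_base)+
        then have "card (insert (axis k 1) (insert w (insert (g e) Xs))) = card Xs + 3"
          by (simp add: Xs_def)
        moreover have "card Xs = CARD('n) - 2" using ind by (simp add: Xs_def card_image)
        ultimately show False using n by simp
      qed
      then obtain u where "g e = (\<Sum>y\<in>Xs. u y *\<^sub>R y)" by (auto simp: span_finite Xs_def)
      then show ?thesis
        using ind by (intro exI[of _ "\<lambda>i. u (x (e, i))"]) (simp add: Xs_def sum.reindex)
    qed
    then obtain c where c: "\<And>e. e \<in> E \<Longrightarrow> g e = (\<Sum>i<CARD('n) - 2. c e i *\<^sub>R x (e, i))" by metis
    have "(\<Sum>h\<in>H. c (fst h) (snd h) *\<^sub>R a h) =
        (\<Sum>e\<in>E. \<Sum>i<CARD('n) - 2. c e i *\<^sub>R edge_vec (s e) (t e) (x (e, i)))"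
      unfolding H_def sum.cartesian_product'
      using x by (intro sum.cong refl) (simp add: H_def)
    also have "\<dots> = (\<Sum>e\<in>E. edge_vec (s e) (t e) (pr (f (s e) e)))"
      by (intro sum.cong refl)
        (simp add: c[unfolded g_def] linear_sum[OF linear_edge_vec] linear_scale[OF linear_edge_vec])
    also have "\<dots> = (\<Sum>v\<in>V. Poly_Mapping.single v (\<Sum>e\<in>{e\<in>E. v \<in> e}. pr (f v e)))"
    proof (rule sum_edge_vec[OF V finE])
      fix e assume e: "e \<in> E"
      then show "e \<subseteq> V \<and> e = {s e, t e} \<and> s e \<noteq> t e \<and> pr (f (t e) e) = - pr (f (s e) e)"
        using st[OF e] E[OF e] neg[OF e] by (simp add: linear_neg[OF lin])
    qed
    also have "\<dots> = 0"
      using bal by (simp add: linear_sum[OF lin, symmetric] linear_0[OF lin])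
    finally have "c e i = 0" if "e \<in> E" "i < CARD('n) - 2" for e i
      using independent_family_rel[OF finH a(2,3), of "\<lambda>h. c (fst h) (snd h)" "(e, i)"] that
      by (simp add: H_def)
    then have g0: "g e = 0" if "e \<in> E" for e using c that by simp
    show "\<forall>e\<in>E. \<forall>v\<in>e. f v e = 0"
    proof (intro ballI)
      fix e v assume e: "e \<in> E" and v: "v \<in> e"
      \<comment> \<open>Once its projection vanishes, the stress points along the axis
        \<open>k\<close>, where \<open>p (s e)\<close> has entry 1, so that orthogonality to
        \<open>p (s e)\<close> leaves only 0.\<close>
      have fe: "f (s e) e = (f (s e) e $ k) *\<^sub>R axis k 1" using g0[OF e] by (simp add: g_def pr_def)
      have "s e \<in> e" using st[OF e] by blast
      then have "(f (s e) e $ k) *\<^sub>R axis k 1 \<bullet> p (s e) = 0" using orth[OF e] fe by metis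
      then have "f (s e) e $ k = 0" by (simp add: inner_axis' pk)
      then have "f (s e) e = 0" using fe by simp
      moreover have "v \<in> {s e, t e}" using v st[OF e] by blast
      ultimately show "f v e = 0" using neg[OF e] by auto
    qed
  qed
  moreover have "p v \<noteq> 0" for v using pk[of v] by auto
  ultimately show ?thesis by blast
qed

section \<open>Stresses and the coboundary\<close>

definition coboundary_onto :: "'v set set \<Rightarrow> ('v \<Rightarrow> 'b::real_vector set) \<Rightarrow> bool"
  where "coboundary_onto E S \<longleftrightarrow>
    (\<forall>y. \<exists>a b. \<forall>e\<in>E. \<forall>v\<in>e. a v - b e - y v e \<in> S v)"

text \<open>The stress \<open>f\<close> is itself taken as the target \<open>y\<close>. Then the sum
  of all \<open>f v e \<bullet> f v e\<close> splits into products with the \<open>a v\<close> and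
  with the \<open>b e\<close>; the former vanish by balance at the vertices, the latter by balance
  over the edges.\<close>

lemma coboundary_onto_imp_stress_free:
  fixes T :: "'v \<Rightarrow> 'b::real_inner set"
  assumes "simple_graph V E" and on: "coboundary_onto E T"
  shows "stress_free V E T"
  unfolding stress_free_def
proof (intro allI impI, elim conjE)
  fix f :: "'v \<Rightarrow> 'v set \<Rightarrow> 'b"
  assume orth: "\<forall>e\<in>E. \<forall>v\<in>e. \<forall>x\<in>T v. f v e \<bullet> x = 0"
    and bal: "\<forall>v\<in>V. (\<Sum>e\<in>{e\<in>E. v \<in> e}. f v e) = 0" and neg: "\<forall>e\<in>E. (\<Sum>v\<in>e. f v e) = 0"
  have V: "finite V" and E: "\<And>e. e \<in> E \<Longrightarrow> e \<subseteq> V"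
    using assms(1) by (auto simp: simple_graph_def)
  have "E \<subseteq> Pow V" using E by auto
  then have finE: "finite E" using V finite_subset by blast
  have fine: "finite e" if "e \<in> E" for e using E[OF that] V finite_subset by blast
  obtain a b where ab: "\<forall>e\<in>E. \<forall>v\<in>e. a v - b e - f v e \<in> T v"
    using on unfolding coboundary_onto_def by blast
  have "(\<Sum>e\<in>E. \<Sum>v\<in>e. f v e \<bullet> f v e) = (\<Sum>e\<in>E. \<Sum>v\<in>e. f v e \<bullet> a v - f v e \<bullet> b e)"
  proof (intro sum.cong refl)
    fix e v assume "e \<in> E" "v \<in> e"
    then have "f v e \<bullet> (a v - b e - f v e) = 0" using orth ab by blast
    then show "f v e \<bullet> f v e = f v e \<bullet> a v - f v e \<bullet> b e" by (simp add: inner_diff_right)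
  qed
  also have "\<dots> = (\<Sum>e\<in>E. \<Sum>v\<in>e. f v e \<bullet> a v) - (\<Sum>e\<in>E. \<Sum>v\<in>e. f v e \<bullet> b e)"
    by (simp add: sum_subtractf)
  also have "(\<Sum>e\<in>E. \<Sum>v\<in>e. f v e \<bullet> b e) = 0"
    using neg by (simp flip: inner_sum_left)
  also have "(\<Sum>e\<in>E. \<Sum>v\<in>e. f v e \<bullet> a v) = (\<Sum>e\<in>E. \<Sum>v\<in>{v\<in>V. v \<in> e}. f v e \<bullet> a v)"
    using E by (intro sum.cong refl) auto
  also have "\<dots> = (\<Sum>v\<in>V. \<Sum>e\<in>{e\<in>E. v \<in> e}. f v e \<bullet> a v)"
    by (rule sum.swap_restrict[OF finE V])
  also have "\<dots> = 0" using bal by (simp flip: inner_sum_left)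
  finally have "(\<Sum>e\<in>E. \<Sum>v\<in>e. f v e \<bullet> f v e) = 0" by simp
  then have "\<forall>e\<in>E. (\<Sum>v\<in>e. f v e \<bullet> f v e) = 0"
    using finE by (subst (asm) sum_nonneg_eq_0_iff) (auto intro: sum_nonneg)
  then show "\<forall>e\<in>E. \<forall>v\<in>e. f v e = 0"
    using fine by (auto simp: sum_nonneg_eq_0_iff)
qed

text \<open>If \<open>y\<close> is not attained, some functional vanishes on all attained targets
  but not on \<open>y\<close>. Its values on the coordinate vectors form a stress, which must be 0,
  and then the functional vanishes on \<open>y\<close> as well.\<close>

lemma stress_free_imp_coboundary_onto:
  fixes T :: "'v \<Rightarrow> (real^'n) set"
  assumes "simple_graph V E" and T: "\<And>v. v \<in> V \<Longrightarrow> subspace (T v)" and free: "stress_free V E T"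
  shows "coboundary_onto E T"
proof (rule ccontr)
  assume "\<not> coboundary_onto E T"
  then obtain y where y: "\<And>a b. \<exists>e\<in>E. \<exists>v\<in>e. a v - b e - y v e \<notin> T v"
    unfolding coboundary_onto_def by blast
  have V: "finite V" and E: "\<And>e. e \<in> E \<Longrightarrow> e \<subseteq> V"
    using assms(1) by (auto simp: simple_graph_def)
  have "E \<subseteq> Pow V" using E by auto
  then have finE: "finite E" using V finite_subset by blast
  have fine: "finite e" if "e \<in> E" for e using E[OF that] V finite_subset by blast
  define I where "I = (SIGMA e:E. e)"
  have finI: "finite I" using finE fine by (auto simp: I_def)
  define im where "im = {g :: 'v set \<times> 'v \<Rightarrow>\<^sub>0 real^'n.
    \<exists>a b. \<forall>e\<in>E. \<forall>v\<in>e. a v - b e - Poly_Mapping.lookup g (e, v) \<in> T v}"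
  have sim: "subspace im"
    unfolding subspace_def
  proof (intro conjI ballI allI)
    show "0 \<in> im" using T E subspace_0 by (fastforce simp: im_def intro!: exI[of _ "\<lambda>_. 0"])
    fix g assume "g \<in> im"
    then obtain a b where ab: "\<forall>e\<in>E. \<forall>v\<in>e. a v - b e - Poly_Mapping.lookup g (e, v) \<in> T v"
      by (auto simp: im_def)
    show "c *\<^sub>R g \<in> im" for c
      unfolding im_def mem_Collect_eq
    proof (intro exI ballI)
      fix e v assume ev: "e \<in> E" "v \<in> e"
      have "c *\<^sub>R (a v - b e - Poly_Mapping.lookup g (e, v)) \<in> T v"
        using ab ev E T by (blast intro: subspace_scale)
      then show "c *\<^sub>R a v - c *\<^sub>R b e - Poly_Mapping.lookup (c *\<^sub>R g) (e, v) \<in> T v"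
        by (simp add: lookup_scaleR algebra_simps)
    qed
    fix g' assume "g' \<in> im"
    then obtain a' b' where ab': "\<forall>e\<in>E. \<forall>v\<in>e. a' v - b' e - Poly_Mapping.lookup g' (e, v) \<in> T v"
      by (auto simp: im_def)
    show "g + g' \<in> im"
      unfolding im_def mem_Collect_eq
    proof (intro exI ballI)
      fix e v assume ev: "e \<in> E" "v \<in> e"
      have "(a v - b e - Poly_Mapping.lookup g (e, v)) + (a' v - b' e - Poly_Mapping.lookup g' (e, v)) \<in> T v"
        using ab ab' ev E T by (blast intro: subspace_add)
      then show "(a v + a' v) - (b e + b' e) - Poly_Mapping.lookup (g + g') (e, v) \<in> T v"
        by (simp add: lookup_add algebra_simps)
    qed
  qed
  define Y where "Y = (\<Sum>(e, v)\<in>I. Poly_Mapping.single (e, v) (y v e))"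
  have lY: "Poly_Mapping.lookup Y (e, v) = y v e" if "e \<in> E" "v \<in> e" for e v
  proof -
    have "Poly_Mapping.lookup Y (e, v) = (\<Sum>i\<in>I. if i = (e, v) then y v e else 0)"
      unfolding Y_def lookup_sum by (intro sum.cong) (auto simp: lookup_single when_def split: if_splits)
    then show ?thesis using finI that by (simp add: I_def)
  qed
  have "Y \<notin> im" using y by (simp add: im_def lY)
  then have "Y \<notin> span im" using sim by (simp add: span_eq_iff[THEN iffD2])
  then obtain \<psi> :: "('v set \<times> 'v \<Rightarrow>\<^sub>0 real^'n) \<Rightarrow> real"
    where \<psi>: "linear \<psi>" "\<And>g. g \<in> im \<Longrightarrow> \<psi> g = 0" "\<psi> Y \<noteq> 0"
    using functional_separating[of "{Y}" im] by (auto simp: span_base)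
  define f :: "'v \<Rightarrow> 'v set \<Rightarrow> real^'n"
    where "f = (\<lambda>v e. \<chi> j. \<psi> (Poly_Mapping.single (e, v) (axis j 1)))"
  have f: "\<psi> (Poly_Mapping.single (e, v) x) = f v e \<bullet> x" for e v x
  proof -
    have lin: "linear (\<lambda>y. \<psi> (Poly_Mapping.single (e, v) y))"
      using linear_compose[OF linear_single \<psi>(1)] by (simp add: o_def)
    have "x = (\<Sum>j\<in>UNIV. (x $ j) *\<^sub>R axis j 1)" by (simp add: basis_expansion flip: scalar_mult_eq_scaleR)
    then have "\<psi> (Poly_Mapping.single (e, v) x) =
        \<psi> (Poly_Mapping.single (e, v) (\<Sum>j\<in>UNIV. (x $ j) *\<^sub>R axis j 1))"
      by simp
    also have "\<dots> = (\<Sum>j\<in>UNIV. (x $ j) * \<psi> (Poly_Mapping.single (e, v) (axis j 1)))"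
      by (simp add: linear_sum[OF lin] linear_scale[OF lin])
    also have "\<dots> = f v e \<bullet> x"
      unfolding inner_vec_def by (rule sum.cong) (auto simp: f_def)
    finally show ?thesis .
  qed
  have lk: "Poly_Mapping.lookup (Poly_Mapping.single i x) j = (if i = j then x else 0)"
    for i j :: "'v set \<times> 'v" and x :: "real^'n"
    by (simp add: lookup_single when_def)
  \<comment> \<open>Three kinds of attained targets give the three conditions on a stress: a vector
    of \<open>T v\<close> at one incidence, the effect of moving one vertex, and the effect of
    moving one edge.\<close>
  have "\<forall>e\<in>E. \<forall>v\<in>e. \<forall>x\<in>T v. f v e \<bullet> x = 0"
  proof (intro ballI)
    fix e v x assume ev: "e \<in> E" "v \<in> e" "x \<in> T v"
    have "Poly_Mapping.single (e, v) x \<in> im"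
      unfolding im_def mem_Collect_eq
    proof (intro exI ballI)
      fix e' v' assume ev': "e' \<in> E" "v' \<in> e'"
      then have "0 \<in> T v'" using T E subspace_0 by blast
      moreover have "- x \<in> T v" using T E ev subspace_neg by blast
      ultimately show "0 - 0 - Poly_Mapping.lookup (Poly_Mapping.single (e, v) x) (e', v') \<in> T v'"
        by (auto simp: lk)
    qed
    then show "f v e \<bullet> x = 0" using \<psi>(2) f by metis
  qed
  moreover have "\<forall>v\<in>V. (\<Sum>e\<in>{e\<in>E. v \<in> e}. f v e) = 0"
  proof
    fix v assume v: "v \<in> V"
    have "(\<Sum>e\<in>{e\<in>E. v \<in> e}. f v e) \<bullet> x = 0" for x
    proof -
      have "(\<Sum>e\<in>{e\<in>E. v \<in> e}. Poly_Mapping.single (e, v) x) \<in> im"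
        unfolding im_def mem_Collect_eq
      proof (intro exI ballI)
        fix e' v' assume ev': "e' \<in> E" "v' \<in> e'"
        then have "0 \<in> T v'" using T E subspace_0 by blast
        moreover have "Poly_Mapping.lookup (\<Sum>e\<in>{e\<in>E. v \<in> e}. Poly_Mapping.single (e, v) x) (e', v') =
            (if v' = v then x else 0)"
          using finE ev' by (auto simp: lookup_sum lk if_distrib sum.delta')
        ultimately show "(if v' = v then x else 0) - 0 -
            Poly_Mapping.lookup (\<Sum>e\<in>{e\<in>E. v \<in> e}. Poly_Mapping.single (e, v) x) (e', v') \<in> T v'"
          by simp
      qed
      then have "\<psi> (\<Sum>e\<in>{e\<in>E. v \<in> e}. Poly_Mapping.single (e, v) x) = 0" by (rule \<psi>(2))
      then show ?thesis by (simp add: linear_sum[OF \<psi>(1)] f inner_sum_left)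
    qed
    then show "(\<Sum>e\<in>{e\<in>E. v \<in> e}. f v e) = 0" using inner_eq_zero_iff by blast
  qed
  moreover have "\<forall>e\<in>E. (\<Sum>v\<in>e. f v e) = 0"
  proof
    fix e assume e: "e \<in> E"
    have "(\<Sum>v\<in>e. f v e) \<bullet> x = 0" for x
    proof -
      have "(\<Sum>v\<in>e. Poly_Mapping.single (e, v) x) \<in> im"
        unfolding im_def mem_Collect_eq
      proof (intro exI ballI)
        fix e' v' assume ev': "e' \<in> E" "v' \<in> e'"
        then have "0 \<in> T v'" using T E subspace_0 by blast
        moreover have "Poly_Mapping.lookup (\<Sum>v\<in>e. Poly_Mapping.single (e, v) x) (e', v') =
            (if e' = e then x else 0)"
          using fine[OF e] ev' by (auto simp: lookup_sum lk if_distrib sum.delta')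
        ultimately show "0 - (if e' = e then - x else 0) -
            Poly_Mapping.lookup (\<Sum>v\<in>e. Poly_Mapping.single (e, v) x) (e', v') \<in> T v'"
          by simp
      qed
      then have "\<psi> (\<Sum>v\<in>e. Poly_Mapping.single (e, v) x) = 0" by (rule \<psi>(2))
      then show ?thesis by (simp add: linear_sum[OF \<psi>(1)] f inner_sum_left)
    qed
    then show "(\<Sum>v\<in>e. f v e) = 0" using inner_eq_zero_iff by blast
  qed
  ultimately have f0: "\<forall>e\<in>E. \<forall>v\<in>e. f v e = 0" using free unfolding stress_free_def by blast
  have "\<psi> Y = (\<Sum>(e, v)\<in>I. f v e \<bullet> y v e)"
    unfolding Y_def linear_sum[OF \<psi>(1)] by (intro sum.cong) (auto simp: f)
  also have "\<dots> = 0" using f0 by (intro sum.neutral) (auto simp: I_def)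
  finally show False using \<psi>(3) by simp
qed

text \<open>The vectors of the edges inside \<open>W\<close> are completed by lifts of the n axes
  under the total sum, and the size of this independent family is compared with that of a spanning
  set. A relation between edge vectors would be a stress; the lifts come from one edge of
  \<open>W\<close>, whose ends carry distinct lines.\<close>

lemma stress_free_imp_sparse:
  fixes p :: "'v \<Rightarrow> real^'n"
  assumes G: "simple_graph V E" and n: "3 \<le> CARD('n)"
    and p: "\<And>v. v \<in> V \<Longrightarrow> p v \<noteq> 0"
    and distinct: "\<And>e u v. e \<in> E \<Longrightarrow> u \<in> e \<Longrightarrow> v \<in> e \<Longrightarrow> u \<noteq> v \<Longrightarrow> p u \<notin> span {p v}"
    and free: "stress_free V E (\<lambda>v. span {p v})"
    and W: "W \<subseteq> V" "2 \<le> card W"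
  shows "(CARD('n) - 2) * card {e \<in> E. e \<subseteq> W} + CARD('n) \<le> (CARD('n) - 1) * card W"
proof (cases "{e \<in> E. e \<subseteq> W} = {}")
  case True
  \<comment> \<open>Without an edge inside \<open>W\<close> there is no pair of distinct lines at
    hand, but the claim reduces to n <= (n - 1) * card W, where \<open>card W\<close> is at least
    2.\<close>
  obtain m where m: "CARD('n) = m + 3" using n by (metis add.commute le_Suc_ex)
  have "(CARD('n) - 1) * 2 \<le> (CARD('n) - 1) * card W" using W(2) by (rule mult_le_mono2)
  then show ?thesis unfolding True card.empty using m by simp
next
  case False
  define EW where "EW = {e \<in> E. e \<subseteq> W}"
  have V: "finite V" and E: "\<And>e. e \<in> E \<Longrightarrow> e \<subseteq> V"
    using G by (auto simp: simple_graph_def)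
  have "E \<subseteq> Pow V" using E by auto
  then have "finite E" using V finite_subset by blast
  then have finE: "finite E" "finite EW" by (auto simp: EW_def)
  have finW: "finite W" using W V finite_subset by blast
  obtain s t where st: "\<And>e. e \<in> E \<Longrightarrow> e = {s e, t e} \<and> s e \<noteq> t e"
    using oriented_edges[OF G] by blast
  have st2: "s e \<in> W" "t e \<in> W" "s e \<in> e" "t e \<in> e" "s e \<noteq> t e" "e \<in> E" if "e \<in> EW" for e
    using st[of e] that by (auto simp: EW_def)
  have dimo: "dim {y. \<forall>x\<in>span X. orthogonal x y} + dim X = CARD('n)" for X :: "(real^'n) set"
    using dim_subspace_orthogonal_to_vectors[of "span X" UNIV] by simp
  have "\<exists>\<beta>. finite \<beta> \<and> card \<beta> = CARD('n) - 1 \<and> {y. y \<bullet> p v = 0} \<subseteq> span \<beta>" if v: "v \<in> V" for v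
  proof -
    define Z where "Z = {y. \<forall>x\<in>span {p v}. orthogonal x y}"
    have sub: "{y. y \<bullet> p v = 0} \<subseteq> Z"
      by (auto simp: Z_def span_singleton orthogonal_def inner_commute)
    have "dim Z = CARD('n) - 1"
      using dimo[of "{p v}"] p[OF v] by (simp add: Z_def dim_insert)
    moreover obtain \<beta> where "\<beta> \<subseteq> Z" "independent \<beta>" "Z \<subseteq> span \<beta>" "card \<beta> = dim Z"
      by (rule basis_exists)
    ultimately show ?thesis
      using sub independent_imp_finite[of \<beta>] by (intro exI[of _ \<beta>]) (simp add: subset_trans)
  qed
  then obtain \<beta> where \<beta>: "\<And>v. v \<in> V \<Longrightarrow> finite (\<beta> v) \<and> card (\<beta> v) = CARD('n) - 1 \<and>
      {y. y \<bullet> p v = 0} \<subseteq> span (\<beta> v)" by metis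
  have "\<exists>\<gamma>. finite \<gamma> \<and> independent \<gamma> \<and> CARD('n) - 2 \<le> card \<gamma> \<and> (\<forall>y\<in>\<gamma>. y \<bullet> p (s e) = 0 \<and> y \<bullet> p (t e) = 0)" for e
  proof -
    obtain \<gamma> where \<gamma>: "\<gamma> \<subseteq> {y. \<forall>x\<in>span {p (s e), p (t e)}. orthogonal x y}" "independent \<gamma>"
      "{y. \<forall>x\<in>span {p (s e), p (t e)}. orthogonal x y} \<subseteq> span \<gamma>"
      "card \<gamma> = dim {y. \<forall>x\<in>span {p (s e), p (t e)}. orthogonal x y}"
      by (rule basis_exists)
    have "dim {p (s e), p (t e)} \<le> card {p (s e), p (t e)}" by (intro dim_le_card') simp
    also have "\<dots> \<le> 2" using card_insert_le_m1[of 2 "{p (t e)}" "p (s e)"] by simp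
    finally have "CARD('n) - 2 \<le> card \<gamma>" using dimo[of "{p (s e), p (t e)}"] \<gamma>(4) by simp
    moreover have "y \<bullet> p (s e) = 0 \<and> y \<bullet> p (t e) = 0" if "y \<in> \<gamma>" for y
      using \<gamma>(1) that by (auto simp: orthogonal_def inner_commute intro: span_base)
    ultimately show ?thesis using \<gamma>(2) independent_bound[OF \<gamma>(2)] by blast
  qed
  then obtain \<gamma> where \<gamma>: "\<And>e. finite (\<gamma> e) \<and> independent (\<gamma> e) \<and> CARD('n) - 2 \<le> card (\<gamma> e) \<and>
    (\<forall>y\<in>\<gamma> e. y \<bullet> p (s e) = 0 \<and> y \<bullet> p (t e) = 0)" by metis
  obtain e0 where e0: "e0 \<in> EW" using False by (auto simp: EW_def)
  define u0 v0 where "u0 = s e0" and "v0 = t e0"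
  have uv0: "u0 \<in> W" "v0 \<in> W" "u0 \<noteq> v0" and "p u0 \<notin> span {p v0}"
    using st2[OF e0] distinct[of e0 "s e0" "t e0"] by (auto simp: u0_def v0_def)
  \<comment> \<open>The component of \<open>p u0\<close> orthogonal to \<open>p v0\<close> is
    nonzero because the two lines differ; \<open>r\<close> is a multiple of it.\<close>
  have "\<exists>r. r \<bullet> p v0 = 0 \<and> r \<bullet> p u0 = 1"
  proof -
    define w where "w = p u0 - ((p u0 \<bullet> p v0) / (p v0 \<bullet> p v0)) *\<^sub>R p v0"
    have w0: "w \<noteq> 0"
    proof
      assume "w = 0"
      then have "p u0 = ((p u0 \<bullet> p v0) / (p v0 \<bullet> p v0)) *\<^sub>R p v0" by (simp add: w_def)
      then show False using \<open>p u0 \<notin> span {p v0}\<close> by (metis insertI1 span_base span_scale)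
    qed
    have wv: "w \<bullet> p v0 = 0" using p uv0 W by (auto simp: w_def inner_diff_left)
    have "w \<bullet> w = w \<bullet> p u0" using wv by (subst (2) w_def) (simp add: inner_diff_right)
    then have "w \<bullet> p u0 \<noteq> 0" using w0 by (metis inner_eq_zero_iff)
    then show ?thesis using wv by (intro exI[of _ "(1 / (w \<bullet> p u0)) *\<^sub>R w"]) simp
  qed
  then obtain r where r: "r \<bullet> p v0 = 0" "r \<bullet> p u0 = 1" by blast
  \<comment> \<open>A linear right inverse of the total sum. The part at \<open>u0\<close> is
    orthogonal to \<open>p u0\<close> since \<open>r \<bullet> p u0 = 1\<close>, the part at
    \<open>v0\<close> is orthogonal to \<open>p v0\<close>, and the two parts add up to
    \<open>x\<close>.\<close>
  define z where "z = (\<lambda>x. Poly_Mapping.single u0 (x - (x \<bullet> p u0) *\<^sub>R r) +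
    Poly_Mapping.single v0 ((x \<bullet> p u0) *\<^sub>R r))"
  define I where "I = (SIGMA e:EW. \<gamma> e)"
  define b where "b = case_sum (\<lambda>(e, x). edge_vec (s e) (t e) x) (\<lambda>j :: 'n. z (axis j 1))"
  have finI: "finite I" using finE \<gamma> by (auto simp: I_def)
  have ind: "inj_on b (I <+> UNIV) \<and> independent (b ` (I <+> UNIV))"
  proof (rule independent_family)
    fix c assume c: "(\<Sum>i\<in>I <+> UNIV. c i *\<^sub>R b i) = 0"
    have split: "(\<Sum>i\<in>I. c (Inl i) *\<^sub>R edge_vec (s (fst i)) (t (fst i)) (snd i)) +
        (\<Sum>j\<in>UNIV. c (Inr j) *\<^sub>R z (axis j 1)) = 0"
      using c finI by (simp add: sum.Plus b_def case_prod_beta)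
    \<comment> \<open>The total sum kills the edge vectors and maps \<open>z x\<close> back to
      \<open>x\<close>. Applied to a relation it shows that the lifts have coefficients 0, which
      leaves a relation between edge vectors alone.\<close>
    define tot where "tot = (\<lambda>g :: 'v \<Rightarrow>\<^sub>0 real^'n. \<Sum>v\<in>W. Poly_Mapping.lookup g v)"
    have lin: "linear tot"
      by (rule linearI) (simp_all add: tot_def lookup_add lookup_scaleR sum.distrib scaleR_sum_right)
    have ts: "tot (Poly_Mapping.single v x) = x" if "v \<in> W" for v x
      using that finW by (simp add: tot_def lookup_single when_def)
    have te: "tot (edge_vec (s (fst i)) (t (fst i)) (snd i)) = 0" if "i \<in> I" for i
      using that st2 by (auto simp: I_def edge_vec_def linear_diff[OF lin] ts)
    have tz: "tot (z x) = x" for x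
      using uv0 by (simp add: z_def linear_add[OF lin] ts)
    have "(\<Sum>j\<in>UNIV. c (Inr j) *\<^sub>R axis j (1::real)) = 0"
      using arg_cong[OF split, of tot]
      by (simp add: linear_add[OF lin] linear_sum[OF lin] linear_scale[OF lin] te tz linear_0[OF lin])
    then have "(\<Sum>j\<in>UNIV. c (Inr j) *\<^sub>R axis j (1::real)) $ i = 0" for i by simp
    then have cr: "c (Inr j) = 0" for j
      by (simp add: axis_def if_distrib cong: if_cong)
    \<comment> \<open>Extension by 0 to the edges outside \<open>W\<close> turns the relation into a
      stress of the whole graph, to which \<open>free\<close> applies.\<close>
    define g where "g = (\<lambda>e. if e \<in> EW then \<Sum>x\<in>\<gamma> e. c (Inl (e, x)) *\<^sub>R x else 0)"
    define f where "f = (\<lambda>v e. if v = s e then g e else - g e)"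
    have "(\<Sum>e\<in>E. edge_vec (s e) (t e) (g e)) = (\<Sum>e\<in>EW. edge_vec (s e) (t e) (g e))"
      using finE by (intro sum.mono_neutral_right) (auto simp: EW_def g_def linear_0[OF linear_edge_vec])
    also have "\<dots> = (\<Sum>e\<in>EW. \<Sum>x\<in>\<gamma> e. c (Inl (e, x)) *\<^sub>R edge_vec (s e) (t e) x)"
      by (simp add: g_def linear_sum[OF linear_edge_vec] linear_scale[OF linear_edge_vec])
    also have "\<dots> = 0"
      using split cr finE \<gamma> by (simp add: I_def sum.Sigma case_prod_beta)
    finally have z: "(\<Sum>e\<in>E. edge_vec (s e) (t e) (g e)) = 0" .
    have "(\<Sum>e\<in>E. edge_vec (s e) (t e) (g e)) = (\<Sum>e\<in>E. edge_vec (s e) (t e) (f (s e) e))"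
      by (simp add: f_def)
    also have "\<dots> = (\<Sum>v\<in>V. Poly_Mapping.single v (\<Sum>e\<in>{e\<in>E. v \<in> e}. f v e))"
    proof (rule sum_edge_vec[OF V finE(1)])
      fix e assume e: "e \<in> E"
      have "t e \<noteq> s e" using st[OF e] by metis
      then have "f (t e) e = - f (s e) e" by (simp add: f_def)
      then show "e \<subseteq> V \<and> e = {s e, t e} \<and> s e \<noteq> t e \<and> f (t e) e = - f (s e) e"
        using st[OF e] E[OF e] by blast
    qed
    finally have "(\<Sum>v\<in>V. Poly_Mapping.single v (\<Sum>e\<in>{e\<in>E. v \<in> e}. f v e)) = 0"
      using z by simp
    then have lk: "Poly_Mapping.lookup (\<Sum>v\<in>V. Poly_Mapping.single v (\<Sum>e\<in>{e\<in>E. v \<in> e}. f v e)) v = 0" for v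
      by simp
    have bal: "(\<Sum>e\<in>{e\<in>E. v \<in> e}. f v e) = 0" if "v \<in> V" for v
      using lk[of v] that V by (simp add: lookup_sum lookup_single when_def)
    have gp: "g e \<bullet> p (s e) = 0 \<and> g e \<bullet> p (t e) = 0" for e
      using \<gamma>[of e] by (simp add: g_def inner_sum_left)
    have "\<forall>e\<in>E. \<forall>v\<in>e. f v e = 0"
    proof -
      have "\<forall>e\<in>E. \<forall>v\<in>e. \<forall>x\<in>span {p v}. f v e \<bullet> x = 0"
      proof (intro ballI)
        fix e v x assume "e \<in> E" "v \<in> e" "x \<in> span {p v}"
        then have "v \<in> {s e, t e}" "\<exists>k. x = k *\<^sub>R p v" using st by (auto simp: span_singleton)
        then show "f v e \<bullet> x = 0" using gp[of e] by (auto simp: f_def)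
      qed
      moreover have "\<forall>e\<in>E. (\<Sum>v\<in>e. f v e) = 0"
      proof
        fix e assume "e \<in> E"
        have "s e \<noteq> t e" using st[OF \<open>e \<in> E\<close>] by blast
        then have "(\<Sum>v\<in>{s e, t e}. f v e) = 0" by (simp add: f_def)
        then show "(\<Sum>v\<in>e. f v e) = 0" using st[OF \<open>e \<in> E\<close>] by metis
      qed
      ultimately show ?thesis using free bal unfolding stress_free_def by blast
    qed
    then have "g e = 0" if "e \<in> EW" for e using st2[OF that] by (metis f_def)
    then have "c (Inl (e, x)) = 0" if "e \<in> EW" "x \<in> \<gamma> e" for e x
      using that \<gamma>[of e] independentD[of "\<gamma> e" "\<gamma> e" "\<lambda>x. c (Inl (e, x))" x] by (simp add: g_def)
    then show "\<forall>i\<in>I <+> UNIV. c i = 0" using cr by (auto simp: I_def)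
  qed (use finI in simp)
  \<comment> \<open>The sets \<open>\<beta> v\<close>, each placed at its vertex, span all families
    on \<open>W\<close> that are orthogonal to the lines; together they have at most (n - 1) * card
    W members.\<close>
  define Y where "Y = (\<Union>v\<in>W. Poly_Mapping.single v ` \<beta> v)"
  have finY: "finite Y" using finW \<beta> W by (auto simp: Y_def)
  have "card Y \<le> (\<Sum>v\<in>W. card (Poly_Mapping.single v ` \<beta> v))"
    unfolding Y_def by (rule card_UN_le[OF finW])
  also have "\<dots> \<le> (\<Sum>v\<in>W. CARD('n) - 1)"
    using \<beta> W by (intro sum_mono) (metis card_image_le subsetD)
  finally have cY: "card Y \<le> (CARD('n) - 1) * card W" by (simp add: mult.commute)
  have spY: "Poly_Mapping.single v x \<in> span Y" if "v \<in> W" "x \<bullet> p v = 0" for v x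
  proof -
    have "x \<in> span (\<beta> v)" using \<beta>[of v] that W by auto
    then have "Poly_Mapping.single v x \<in> span (Poly_Mapping.single v ` \<beta> v)"
      unfolding linear_span_image[OF linear_single] by (rule imageI)
    moreover have "Poly_Mapping.single v ` \<beta> v \<subseteq> Y" using that(1) unfolding Y_def by blast
    ultimately show ?thesis using span_mono by (metis subsetD)
  qed
  have "b i \<in> span Y" if i: "i \<in> I <+> UNIV" for i
  proof (cases i)
    case (Inl h)
    then obtain e x where "h = (e, x)" "e \<in> EW" "x \<in> \<gamma> e" using i by (auto simp: I_def)
    then show ?thesis using Inl st2[of e] \<gamma>[of e] by (auto simp: b_def edge_vec_def intro!: span_diff spY)
  next
    case (Inr j)
    then show ?thesis using uv0 r
      by (auto simp: b_def z_def inner_diff_left intro!: span_add spY)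
  qed
  then have "card (b ` (I <+> UNIV)) \<le> card Y"
    using independent_span_bound[OF finY, of "b ` (I <+> UNIV)"] ind by blast
  then have "card I + CARD('n) \<le> (CARD('n) - 1) * card W"
    using ind cY finI by (simp add: card_image card_Plus)
  moreover have "(CARD('n) - 2) * card EW \<le> card I"
    using \<gamma> finE sum_mono[of EW "\<lambda>_. CARD('n) - 2" "\<lambda>e. card (\<gamma> e)"]
    by (simp add: I_def card_SigmaI mult.commute)
  ultimately show ?thesis unfolding EW_def by linarith
qed

section \<open>Zariski open conditions\<close>

text \<open>Gaussian elimination over the ring of polynomials, without division.\<close>

lemma nonsingular_nearby:
  fixes R :: "('j \<Rightarrow> ('v \<Rightarrow> real^'n^'n) \<Rightarrow> real) set"
  assumes "finite J" "\<And>r j. r \<in> R \<Longrightarrow> j \<in> J \<Longrightarrow> r j \<in> polynomial_functions V"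
    and "\<And>l. \<forall>r\<in>R. (\<Sum>j\<in>J. r j P0 * l j) = 0 \<Longrightarrow> \<forall>j\<in>J. l j = 0"
  shows "\<exists>q\<in>polynomial_functions V. q P0 \<noteq> 0 \<and>
    (\<forall>P. q P \<noteq> 0 \<longrightarrow> (\<forall>l. (\<forall>r\<in>R. (\<Sum>j\<in>J. r j P * l j) = 0) \<longrightarrow> (\<forall>j\<in>J. l j = 0)))"
  using assms
proof (induction J arbitrary: R)
  case empty
  then show ?case using polynomial_functions.const[of 1] by (intro bexI[of _ "\<lambda>P. 1"]) auto
next
  case (insert k J)
  have "\<exists>r\<in>R. r k P0 \<noteq> 0"
  proof (rule ccontr)
    assume "\<not> (\<exists>r\<in>R. r k P0 \<noteq> 0)"
    then have "\<forall>r\<in>R. (\<Sum>j\<in>insert k J. r j P0 * (if j = k then 1 else 0)) = 0"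
      by (intro ballI sum.neutral) auto
    then have "\<forall>j\<in>insert k J. (if j = k then 1 else 0 :: real) = 0" by (rule insert.prems(2))
    then show False by simp
  qed
  then obtain r0 where r0: "r0 \<in> R" "r0 k P0 \<noteq> 0" by blast
  define red where "red = (\<lambda>r j (P :: 'v \<Rightarrow> real^'n^'n). r0 k P * r j P - r k P * r0 j P)"
  have red_sum: "(\<Sum>j\<in>J. red r j P * l j) =
      r0 k P * (\<Sum>j\<in>J. r j P * l j) - r k P * (\<Sum>j\<in>J. r0 j P * l j)" for r P l
    by (simp add: red_def sum_distrib_left sum_subtractf algebra_simps)
  have "\<exists>q\<in>polynomial_functions V. q P0 \<noteq> 0 \<and>
    (\<forall>P. q P \<noteq> 0 \<longrightarrow> (\<forall>l. (\<forall>r\<in>red ` R. (\<Sum>j\<in>J. r j P * l j) = 0) \<longrightarrow> (\<forall>j\<in>J. l j = 0)))"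
  proof (rule insert.IH)
    fix r j assume "r \<in> red ` R" "j \<in> J"
    then obtain r' where r': "r' \<in> R" "r = red r'" by blast
    have "(\<lambda>P. r0 k P * r' j P + (\<lambda>P. -1) P * (r' k P * r0 j P)) \<in> polynomial_functions V"
      using insert.prems(1)[OF r'(1)] insert.prems(1)[OF r0(1)] \<open>j \<in> J\<close>
      by (intro polynomial_functions.add polynomial_functions.mult polynomial_functions.const) auto
    then show "r j \<in> polynomial_functions V" by (simp add: r'(2) red_def)
  next
    fix l assume l: "\<forall>r\<in>red ` R. (\<Sum>j\<in>J. r j P0 * l j) = 0"
    \<comment> \<open>Back substitution: the row \<open>r0\<close> dictates the entry at
      \<open>k\<close>, which lifts a solution of the reduced system at \<open>P0\<close> to one of
      the full system.\<close>
    define l' where "l' = (\<lambda>j. if j = k then - (\<Sum>j\<in>J. r0 j P0 * l j) / r0 k P0 else l j)"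
    have sum_l': "(\<Sum>j\<in>insert k J. r j P0 * l' j) =
        (\<Sum>j\<in>J. r j P0 * l j) - r k P0 * (\<Sum>j\<in>J. r0 j P0 * l j) / r0 k P0" for r
    proof -
      have "(\<Sum>j\<in>J. r j P0 * l' j) = (\<Sum>j\<in>J. r j P0 * l j)"
        using insert.hyps by (intro sum.cong) (auto simp: l'_def)
      then show ?thesis using insert.hyps by (simp add: l'_def)
    qed
    have "\<forall>r\<in>R. (\<Sum>j\<in>insert k J. r j P0 * l' j) = 0"
    proof
      fix r assume "r \<in> R"
      then have "r0 k P0 * (\<Sum>j\<in>J. r j P0 * l j) = r k P0 * (\<Sum>j\<in>J. r0 j P0 * l j)"
        using l red_sum[of r P0 l] by auto
      then show "(\<Sum>j\<in>insert k J. r j P0 * l' j) = 0"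
        unfolding sum_l' using r0(2) by (simp add: field_simps)
    qed
    then have l'0: "\<forall>j\<in>insert k J. l' j = 0" by (rule insert.prems(2))
    show "\<forall>j\<in>J. l j = 0"
    proof
      fix j assume "j \<in> J"
      then show "l j = 0" using l'0 insert.hyps(2) by (metis insertCI l'_def)
    qed
  qed
  then obtain q where q: "q \<in> polynomial_functions V" "q P0 \<noteq> 0"
    "\<And>P l. q P \<noteq> 0 \<Longrightarrow> \<forall>r\<in>red ` R. (\<Sum>j\<in>J. r j P * l j) = 0 \<Longrightarrow> \<forall>j\<in>J. l j = 0"
    by blast
  \<comment> \<open>The pivot has to stay nonzero as well, since only then does the row
    \<open>r0\<close> determine \<open>l k\<close> from the other entries.\<close>
  have "(\<lambda>P. r0 k P * q P) \<in> polynomial_functions V"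
    using insert.prems(1)[OF r0(1)] q(1) by (intro polynomial_functions.mult) auto
  moreover have "\<forall>j\<in>insert k J. l j = 0"
    if nz: "r0 k P * q P \<noteq> 0" and l: "\<forall>r\<in>R. (\<Sum>j\<in>insert k J. r j P * l j) = 0" for P l
  proof -
    have s: "(\<Sum>j\<in>J. r j P * l j) = - (r k P * l k)" if "r \<in> R" for r
      using l that insert.hyps by (auto simp: add_eq_0_iff)
    have "\<forall>r\<in>red ` R. (\<Sum>j\<in>J. r j P * l j) = 0" using s r0(1) by (auto simp: red_sum)
    then have "\<forall>j\<in>J. l j = 0" using q(3) nz by auto
    then show ?thesis using s[OF r0(1)] nz by simp
  qed
  ultimately show ?case using q(2) r0(2) by (intro bexI[of _ "\<lambda>P. r0 k P * q P"]) auto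
qed

section \<open>Projection matrices and open conditions on them\<close>

lemma grassmannian_vmul:
  assumes "P \<in> grassmannian s"
  shows "P *v (P *v x) = P *v x" and "(P *v x) \<bullet> y = x \<bullet> (P *v y)"
proof -
  have t: "transpose P = P" and "P ** P = P" using assms by (auto simp: grassmannian_def)
  then show "P *v (P *v x) = P *v x" by (simp add: matrix_vector_mul_assoc)
  have "P *v x = x v* P" using transpose_matrix_vector[of P x] t by simp
  then show "(P *v x) \<bullet> y = x \<bullet> (P *v y)" by (simp add: dot_lmul_matrix)
qed

text \<open>A symmetric idempotent is the orthogonal projection onto its range, so membership and
  orthogonality become linear equations with coefficients from \<open>P\<close>. For an orthonormal
  basis \<open>B\<close> of the range, \<open>P\<close> maps \<open>x\<close> to the sum of the
  \<open>(b \<bullet> x) *\<^sub>R b\<close>; hence the trace is the sum of the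
  \<open>b \<bullet> b\<close>, which is the dimension.\<close>

lemma grassmannian_range:
  assumes P: "P \<in> grassmannian s"
  shows "subspace (range ((*v) P))" and "dim (range ((*v) P)) = s"
    and "x \<in> range ((*v) P) \<longleftrightarrow> P *v x = x"
    and "(\<forall>y\<in>range ((*v) P). x \<bullet> y = 0) \<longleftrightarrow> P *v x = 0"
proof -
  note P2 = grassmannian_vmul(1)[OF P] and Ps = grassmannian_vmul(2)[OF P]
  show sub: "subspace (range ((*v) P))"
    by (rule linear_subspace_image) (auto simp: matrix_vector_mul_linear)
  show mem: "x \<in> range ((*v) P) \<longleftrightarrow> P *v x = x" for x using P2 by (metis rangeE rangeI)
  show "(\<forall>y\<in>range ((*v) P). x \<bullet> y = 0) \<longleftrightarrow> P *v x = 0"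
  proof
    assume "\<forall>y\<in>range ((*v) P). x \<bullet> y = 0"
    then have "(P *v x) \<bullet> (P *v x) = 0" using Ps P2 by (metis rangeI)
    then show "P *v x = 0" by simp
  next
    assume "P *v x = 0"
    then show "\<forall>y\<in>range ((*v) P). x \<bullet> y = 0" using Ps[symmetric] by auto
  qed
  obtain B where B: "B \<subseteq> range ((*v) P)" "pairwise orthogonal B" "\<And>x. x \<in> B \<Longrightarrow> norm x = 1"
    "independent B" "card B = dim (range ((*v) P))" "span B = range ((*v) P)"
    using orthonormal_basis_subspace[OF sub] by metis
  have finB: "finite B" using B(4) independent_imp_finite by blast
  have exp: "P *v x = (\<Sum>b\<in>B. (b \<bullet> x) *\<^sub>R b)" for x
  proof -
    have "P *v x = (\<Sum>b\<in>B. (b \<bullet> (P *v x)) *\<^sub>R b)"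
    proof -
      define z where "z = P *v x - (\<Sum>b\<in>B. (b \<bullet> (P *v x)) *\<^sub>R b)"
      have "z \<bullet> b' = 0" if b': "b' \<in> B" for b'
      proof -
        have "(\<Sum>b\<in>B. (b \<bullet> (P *v x)) *\<^sub>R b) \<bullet> b' = (\<Sum>b\<in>B. if b = b' then b \<bullet> (P *v x) else 0)"
          unfolding inner_sum_left
        proof (intro sum.cong refl)
          fix b assume "b \<in> B"
          then show "((b \<bullet> (P *v x)) *\<^sub>R b) \<bullet> b' = (if b = b' then b \<bullet> (P *v x) else 0)"
            using B(2,3) b' by (auto simp: pairwise_def orthogonal_def dot_square_norm)
        qed
        then have "(\<Sum>b\<in>B. (b \<bullet> (P *v x)) *\<^sub>R b) \<bullet> b' = (P *v x) \<bullet> b'"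
          using b' finB by (simp add: inner_commute)
        then show ?thesis by (simp only: z_def inner_diff_left diff_self)
      qed
      moreover have "z \<in> span B"
        unfolding z_def using B(1) by (intro span_diff span_sum span_scale) (auto simp: B(6))
      ultimately have "orthogonal z z"
        by (intro orthogonal_to_span[of z B z]) (auto simp: orthogonal_def)
      then have "z = 0" by (simp add: orthogonal_def)
      then show ?thesis by (simp add: z_def)
    qed
    also have "\<dots> = (\<Sum>b\<in>B. (b \<bullet> x) *\<^sub>R b)"
    proof (intro sum.cong refl)
      fix b assume "b \<in> B"
      then have "P *v b = b" using B(1) mem by blast
      then show "(b \<bullet> (P *v x)) *\<^sub>R b = (b \<bullet> x) *\<^sub>R b" using Ps[of b x] by simp
    qed
    finally show ?thesis .
  qed
  have "P $ i $ i = (\<Sum>b\<in>B. b $ i * b $ i)" for i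
  proof -
    have "P $ i $ i = (P *v axis i 1) $ i" by (simp add: matrix_vector_mult_basis column_def)
    then show ?thesis by (simp add: exp inner_axis)
  qed
  then have "trace P = (\<Sum>i\<in>UNIV. \<Sum>b\<in>B. b $ i * b $ i)" by (simp add: trace_def)
  also have "\<dots> = (\<Sum>b\<in>B. b \<bullet> b)" by (subst sum.swap) (simp add: inner_vec_def)
  also have "\<dots> = real (card B)" using B(3) by (simp add: dot_square_norm)
  finally show "dim (range ((*v) P)) = s" using P B(5) by (simp add: grassmannian_def)
qed

text \<open>It suffices to surround each point satisfying \<open>C\<close> by a basic open set on
  which \<open>C\<close> holds. The complement is then the common zero set of all polynomials whose
  nonvanishing implies \<open>C\<close>.\<close>

lemma zariski_openI:
  fixes \<phi> :: "real^'n \<Rightarrow> 'a::real_vector" and V :: "'v set"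
  assumes lin: "linear \<phi>" and inj: "inj \<phi>"
    and C: "\<And>P. P \<in> (\<Pi>\<^sub>E v\<in>V. grassmannian s) \<Longrightarrow> C (subspace_family \<phi> V P) \<Longrightarrow>
      \<exists>q\<in>polynomial_functions V. q P \<noteq> 0 \<and>
        (\<forall>P'\<in>(\<Pi>\<^sub>E v\<in>V. grassmannian s). q P' \<noteq> 0 \<longrightarrow> C (subspace_family \<phi> V P'))"
  shows "zariski_open \<phi> s V {S \<in> motion_sheaves s V. C S}"
  unfolding zariski_open_def
proof
  let ?X = "\<Pi>\<^sub>E v\<in>V. grassmannian s :: (real^'n^'n) set"
  define Q where "Q = {q \<in> polynomial_functions V. \<forall>P\<in>?X. q P \<noteq> 0 \<longrightarrow> C (subspace_family \<phi> V P)}"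
  have mem: "subspace_family \<phi> V P \<in> motion_sheaves s V" if P: "P \<in> ?X" for P
  proof -
    have "subspace (\<phi> ` range ((*v) (P v))) \<and> dim (\<phi> ` range ((*v) (P v))) = s" if v: "v \<in> V" for v
    proof -
      have g: "P v \<in> grassmannian s" using P v by auto
      have "dim (\<phi> ` range ((*v) (P v))) = dim (range ((*v) (P v)))"
        by (rule dim_image_eq[OF lin]) (meson inj inj_on_subset subset_UNIV)
      then show ?thesis
        using grassmannian_range(1,2)[OF g] linear_subspace_image[OF lin] by simp
    qed
    then show ?thesis by (auto simp: motion_sheaves_def subspace_family_def)
  qed
  have "{P \<in> ?X. subspace_family \<phi> V P \<notin> {S \<in> motion_sheaves s V. C S}} = {P \<in> ?X. \<forall>q\<in>Q. q P = 0}"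
    using mem C by (auto simp: Q_def) blast
  moreover have "Q \<subseteq> polynomial_functions V" by (auto simp: Q_def)
  ultimately show "zariski_closed_in V ?X
      {P \<in> ?X. subspace_family \<phi> V P \<notin> {S \<in> motion_sheaves s V. C S}}"
    unfolding zariski_closed_in_def by blast
qed auto

text \<open>Stresses solve a homogeneous linear system whose coefficients are constants or entries
  of the projections, because orthogonality to the range of \<open>P v\<close> says that
  \<open>P v\<close> kills the vector. Having only the zero solution persists where a suitable
  polynomial is nonzero.\<close>

lemma stress_free_open:
  fixes P0 :: "'v \<Rightarrow> real^'n^'n"
  assumes "simple_graph V E" and P0: "P0 \<in> (\<Pi>\<^sub>E v\<in>V. grassmannian s)"
    and free: "stress_free V E (\<lambda>v. range ((*v) (P0 v)))"
  shows "\<exists>q\<in>polynomial_functions V. q P0 \<noteq> 0 \<and>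
    (\<forall>P\<in>(\<Pi>\<^sub>E v\<in>V. grassmannian s). q P \<noteq> 0 \<longrightarrow> stress_free V E (\<lambda>v. range ((*v) (P v))))"
proof -
  have V: "finite V" and E: "\<And>e. e \<in> E \<Longrightarrow> e \<subseteq> V"
    using assms(1) by (auto simp: simple_graph_def)
  have "E \<subseteq> Pow V" using E by auto
  then have finE: "finite E" using V finite_subset by blast
  have fine: "finite e" if "e \<in> E" for e using E[OF that] V finite_subset by blast
  define I where "I = (SIGMA e:E. e)"
  have finI: "finite I" using finE fine by (auto simp: I_def)
  define J where "J = I \<times> (UNIV :: 'n set)"
  \<comment> \<open>The unknowns are the coordinates of \<open>f v e\<close>, indexed by
    \<open>((e, v), j)\<close>. The rows \<open>r1\<close> express orthogonality, \<open>r2\<close>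
    balance at a vertex and \<open>r3\<close> balance over an edge.\<close>
  define r1 where "r1 = (\<lambda>i0 i (x :: ('v set \<times> 'v) \<times> 'n) (P :: 'v \<Rightarrow> real^'n^'n).
    if fst x = i0 then P (snd i0) $ i $ snd x else 0)"
  define r2 where "r2 = (\<lambda>v i (x :: ('v set \<times> 'v) \<times> 'n) (P :: 'v \<Rightarrow> real^'n^'n).
    if snd (fst x) = v \<and> snd x = i then 1 else 0 :: real)"
  define r3 where "r3 = (\<lambda>e i (x :: ('v set \<times> 'v) \<times> 'n) (P :: 'v \<Rightarrow> real^'n^'n).
    if fst (fst x) = e \<and> snd x = i then 1 else 0 :: real)"
  define R where "R = {r1 i0 i |i0 i. i0 \<in> I} \<union> {r2 v i |v i. v \<in> V} \<union> {r3 e i |e i. e \<in> E}"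
  have sumJ: "(\<Sum>x\<in>J. h x) = (\<Sum>i0\<in>I. \<Sum>j\<in>UNIV. h (i0, j))" for h :: "_ \<Rightarrow> real"
    unfolding J_def by (rule sum.cartesian_product')
  have s1: "(\<Sum>x\<in>J. r1 i0 i x P * f (snd (fst x)) (fst (fst x)) $ snd x) = (P v *v f v e) $ i"
    if "i0 = (e, v)" "i0 \<in> I" for i0 e v i P and f :: "'v \<Rightarrow> 'v set \<Rightarrow> real^'n"
  proof -
    have "(\<Sum>x\<in>J. r1 i0 i x P * f (snd (fst x)) (fst (fst x)) $ snd x) =
        (\<Sum>i1\<in>I. if i1 = i0 then (P v *v f v e) $ i else 0)"
      unfolding sumJ by (intro sum.cong refl) (auto simp: r1_def that(1) matrix_vector_mult_def)
    then show ?thesis using finI that(2) by simp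
  qed
  have s2: "(\<Sum>x\<in>J. r2 v i x P * f (snd (fst x)) (fst (fst x)) $ snd x) = (\<Sum>e\<in>{e\<in>E. v \<in> e}. f v e) $ i"
    for v i P and f :: "'v \<Rightarrow> 'v set \<Rightarrow> real^'n"
  proof -
    have "(\<Sum>x\<in>J. r2 v i x P * f (snd (fst x)) (fst (fst x)) $ snd x) =
        (\<Sum>(e, v')\<in>I. if v' = v then f v e $ i else 0)"
      unfolding sumJ
    proof (intro sum.cong refl)
      fix i0 assume "i0 \<in> I"
      obtain e v' where "i0 = (e, v')" by (cases i0)
      then show "(\<Sum>j\<in>UNIV. r2 v i (i0, j) P * f (snd (fst (i0, j))) (fst (fst (i0, j))) $ snd (i0, j)) =
          (case i0 of (e, v') \<Rightarrow> if v' = v then f v e $ i else 0)"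
        by (cases "v' = v") (simp_all add: r2_def if_distrib[of "\<lambda>c. c * _"] cong: if_cong)
    qed
    also have "\<dots> = (\<Sum>e\<in>E. \<Sum>v'\<in>e. if v' = v then f v e $ i else 0)"
      unfolding I_def using finE fine by (intro sum.Sigma[symmetric]) auto
    also have "\<dots> = (\<Sum>e\<in>E. if v \<in> e then f v e $ i else 0)"
      using fine by (intro sum.cong) auto
    also have "\<dots> = (\<Sum>e\<in>{e\<in>E. v \<in> e}. f v e $ i)"
      using finE by (rule sum.inter_filter[symmetric])
    finally show ?thesis by simp
  qed
  have s3: "(\<Sum>x\<in>J. r3 e i x P * f (snd (fst x)) (fst (fst x)) $ snd x) = (\<Sum>v\<in>e. f v e) $ i"
    if "e \<in> E" for e i P and f :: "'v \<Rightarrow> 'v set \<Rightarrow> real^'n"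
  proof -
    have "(\<Sum>x\<in>J. r3 e i x P * f (snd (fst x)) (fst (fst x)) $ snd x) =
        (\<Sum>(e', v)\<in>I. if e' = e then f v e $ i else 0)"
      unfolding sumJ
    proof (intro sum.cong refl)
      fix i0 assume "i0 \<in> I"
      obtain e' v where "i0 = (e', v)" by (cases i0)
      then show "(\<Sum>j\<in>UNIV. r3 e i (i0, j) P * f (snd (fst (i0, j))) (fst (fst (i0, j))) $ snd (i0, j)) =
          (case i0 of (e', v) \<Rightarrow> if e' = e then f v e $ i else 0)"
        by (cases "e' = e") (simp_all add: r3_def if_distrib[of "\<lambda>c. c * _"] cong: if_cong)
    qed
    also have "\<dots> = (\<Sum>e'\<in>E. \<Sum>v\<in>e'. if e' = e then f v e $ i else 0)"
      unfolding I_def using finE fine by (intro sum.Sigma[symmetric]) auto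
    also have "\<dots> = (\<Sum>e'\<in>E. if e' = e then (\<Sum>v\<in>e. f v e $ i) else 0)"
      by (intro sum.cong) auto
    finally show ?thesis using finE that by simp
  qed
  have sys: "(\<forall>r\<in>R. (\<Sum>x\<in>J. r x P * f (snd (fst x)) (fst (fst x)) $ snd x) = 0) \<longleftrightarrow>
      (\<forall>e\<in>E. \<forall>v\<in>e. \<forall>x\<in>range ((*v) (P v)). f v e \<bullet> x = 0) \<and>
      (\<forall>v\<in>V. (\<Sum>e\<in>{e\<in>E. v \<in> e}. f v e) = 0) \<and> (\<forall>e\<in>E. (\<Sum>v\<in>e. f v e) = 0)"
    if P: "P \<in> (\<Pi>\<^sub>E v\<in>V. grassmannian s)" for P f
  proof -
    have orth: "(\<forall>x\<in>range ((*v) (P v)). f v e \<bullet> x = 0) \<longleftrightarrow> (\<forall>i. (P v *v f v e) $ i = 0)"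
      if "e \<in> E" "v \<in> e" for e v
    proof -
      have "P v \<in> grassmannian s" using P E that by (auto simp: PiE_iff)
      then show ?thesis by (subst grassmannian_range(4)) (simp_all add: vec_eq_iff)
    qed
    have "(\<forall>r\<in>R. (\<Sum>x\<in>J. r x P * f (snd (fst x)) (fst (fst x)) $ snd x) = 0) \<longleftrightarrow>
      (\<forall>i0\<in>I. \<forall>i. (\<Sum>x\<in>J. r1 i0 i x P * f (snd (fst x)) (fst (fst x)) $ snd x) = 0) \<and>
      (\<forall>v\<in>V. \<forall>i. (\<Sum>x\<in>J. r2 v i x P * f (snd (fst x)) (fst (fst x)) $ snd x) = 0) \<and>
      (\<forall>e\<in>E. \<forall>i. (\<Sum>x\<in>J. r3 e i x P * f (snd (fst x)) (fst (fst x)) $ snd x) = 0)"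
      unfolding R_def by blast
    also have "(\<forall>i0\<in>I. \<forall>i. (\<Sum>x\<in>J. r1 i0 i x P * f (snd (fst x)) (fst (fst x)) $ snd x) = 0) \<longleftrightarrow>
        (\<forall>e\<in>E. \<forall>v\<in>e. \<forall>i. (P v *v f v e) $ i = 0)"
      using s1 by (auto simp: I_def)
    finally show ?thesis using orth by (simp add: s2 s3 vec_eq_iff)
  qed
  have "\<exists>q\<in>polynomial_functions V. q P0 \<noteq> 0 \<and>
    (\<forall>P. q P \<noteq> 0 \<longrightarrow> (\<forall>l. (\<forall>r\<in>R. (\<Sum>x\<in>J. r x P * l x) = 0) \<longrightarrow> (\<forall>x\<in>J. l x = 0)))"
  proof (rule nonsingular_nearby)
    show "finite J" using finI by (simp add: J_def)
    fix r x assume "r \<in> R" "x \<in> J"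
    have "r1 i0 i x \<in> polynomial_functions V" if "i0 \<in> I" for i0 i
    proof -
      have "snd i0 \<in> V" using that E unfolding I_def by fastforce
      then show ?thesis
        unfolding r1_def
        by (cases "fst x = i0") (simp_all add: polynomial_functions.entry polynomial_functions.const)
    qed
    then show "r x \<in> polynomial_functions V"
      using \<open>r \<in> R\<close> unfolding R_def r2_def r3_def by (auto intro: polynomial_functions.const)
  next
    fix l assume l: "\<forall>r\<in>R. (\<Sum>x\<in>J. r x P0 * l x) = 0"
    define f where "f = (\<lambda>v e. \<chi> j. l ((e, v), j))"
    have lf: "l x = f (snd (fst x)) (fst (fst x)) $ snd x" for x by (simp add: f_def)
    have "\<forall>e\<in>E. \<forall>v\<in>e. f v e = 0"
      using free l sys[OF P0, of f] unfolding stress_free_def lf by blast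
    then show "\<forall>x\<in>J. l x = 0" by (auto simp: J_def I_def lf)
  qed
  then obtain q where q: "q \<in> polynomial_functions V" "q P0 \<noteq> 0"
    "\<And>P l. q P \<noteq> 0 \<Longrightarrow> \<forall>r\<in>R. (\<Sum>x\<in>J. r x P * l x) = 0 \<Longrightarrow> \<forall>x\<in>J. l x = 0" by blast
  have "stress_free V E (\<lambda>v. range ((*v) (P v)))"
    if P: "P \<in> (\<Pi>\<^sub>E v\<in>V. grassmannian s)" and "q P \<noteq> 0" for P
    unfolding stress_free_def
  proof (intro allI impI)
    fix f :: "'v \<Rightarrow> 'v set \<Rightarrow> real^'n"
    assume "(\<forall>e\<in>E. \<forall>v\<in>e. \<forall>x\<in>range ((*v) (P v)). f v e \<bullet> x = 0) \<and>
      (\<forall>v\<in>V. (\<Sum>e\<in>{e\<in>E. v \<in> e}. f v e) = 0) \<and> (\<forall>e\<in>E. (\<Sum>v\<in>e. f v e) = 0)"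
    then have l0: "\<forall>x\<in>J. f (snd (fst x)) (fst (fst x)) $ snd x = 0"
      by (intro q(3)[OF \<open>q P \<noteq> 0\<close>] iffD2[OF sys[OF P]])
    show "\<forall>e\<in>E. \<forall>v\<in>e. f v e = 0"
    proof (intro ballI)
      fix e v assume "e \<in> E" "v \<in> e"
      then have "f v e $ j = 0" for j using bspec[OF l0, of "((e, v), j)"] by (simp add: J_def I_def)
      then show "f v e = 0" by (simp add: vec_eq_iff)
    qed
  qed
  then show ?thesis using q by blast
qed

text \<open>A vector lies in both ranges if and only if both projections fix it, which is again a
  linear system with polynomial coefficients. With one unknown vector per edge, a single polynomial
  takes care of all edges.\<close>

lemma distinct_lines_open:
  fixes P0 :: "'v \<Rightarrow> real^'n^'n"
  assumes G: "simple_graph V E" and P0: "P0 \<in> (\<Pi>\<^sub>E v\<in>V. grassmannian s)"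
    and dis: "\<And>e u v. e \<in> E \<Longrightarrow> u \<in> e \<Longrightarrow> v \<in> e \<Longrightarrow> u \<noteq> v \<Longrightarrow>
      range ((*v) (P0 u)) \<inter> range ((*v) (P0 v)) = {0}"
  shows "\<exists>q\<in>polynomial_functions V. q P0 \<noteq> 0 \<and>
    (\<forall>P\<in>(\<Pi>\<^sub>E v\<in>V. grassmannian s). q P \<noteq> 0 \<longrightarrow>
      (\<forall>e\<in>E. \<forall>u\<in>e. \<forall>v\<in>e. u \<noteq> v \<longrightarrow> range ((*v) (P u)) \<inter> range ((*v) (P v)) = {0}))"
proof -
  have V: "finite V" and E: "\<And>e. e \<in> E \<Longrightarrow> e \<subseteq> V"
    using G by (auto simp: simple_graph_def)
  have "E \<subseteq> Pow V" using E by auto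
  then have finE: "finite E" using V finite_subset by blast
  obtain s' t where st: "\<And>e. e \<in> E \<Longrightarrow> e = {s' e, t e} \<and> s' e \<noteq> t e"
    using oriented_edges[OF G] by blast
  define J where "J = E \<times> (UNIV :: 'n set)"
  define r where "r = (\<lambda>e v i (x :: 'v set \<times> 'n) (P :: 'v \<Rightarrow> real^'n^'n).
    if fst x = e then P v $ i $ snd x + (if i = snd x then -1 else 0) else 0)"
  define R where "R = {r e v i |e v i. e \<in> E \<and> v \<in> e}"
  have sm: "(\<Sum>x\<in>J. r e v i x P * f (fst x) $ snd x) = (P v *v f e - f e) $ i"
    if "e \<in> E" for e v i P and f :: "'v set \<Rightarrow> real^'n"
  proof -
    have "(\<Sum>x\<in>J. r e v i x P * f (fst x) $ snd x) =
        (\<Sum>e'\<in>E. \<Sum>j\<in>UNIV. r e v i (e', j) P * f e' $ j)"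
      unfolding J_def by (simp add: sum.cartesian_product')
    also have "\<dots> = (\<Sum>e'\<in>E. if e' = e then (P v *v f e - f e) $ i else 0)"
    proof (intro sum.cong refl)
      fix e' assume "e' \<in> E"
      show "(\<Sum>j\<in>UNIV. r e v i (e', j) P * f e' $ j) = (if e' = e then (P v *v f e - f e) $ i else 0)"
      proof (cases "e' = e")
        case True
        have "(\<Sum>j\<in>UNIV. r e v i (e', j) P * f e' $ j) =
            (\<Sum>j\<in>UNIV. P v $ i $ j * f e $ j) + (\<Sum>j\<in>UNIV. if i = j then - f e $ j else 0)"
          unfolding sum.distrib[symmetric] by (intro sum.cong) (auto simp: r_def True algebra_simps)
        then show ?thesis using True by (simp add: matrix_vector_mult_def)
      qed (simp add: r_def)
    qed
    finally show ?thesis using finE that by simp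
  qed
  have "\<exists>q\<in>polynomial_functions V. q P0 \<noteq> 0 \<and>
    (\<forall>P. q P \<noteq> 0 \<longrightarrow> (\<forall>l. (\<forall>r\<in>R. (\<Sum>x\<in>J. r x P * l x) = 0) \<longrightarrow> (\<forall>x\<in>J. l x = 0)))"
  proof (rule nonsingular_nearby)
    show "finite J" using finE by (simp add: J_def)
    fix r' x assume "r' \<in> R" "x \<in> J"
    then obtain e v i where r': "r' = r e v i" "e \<in> E" "v \<in> e" by (auto simp: R_def)
    then have vV: "v \<in> V" using E by blast
    show "r' x \<in> polynomial_functions V"
    proof (cases "fst x = e")
      case True
      have "r' x = (\<lambda>P. P v $ i $ snd x + (\<lambda>P. if i = snd x then -1 else 0) P)"
        by (simp add: r' r_def True)
      then show ?thesis
        using vV by (simp only:) (intro polynomial_functions.add polynomial_functions.entry polynomial_functions.const)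
    next
      case False
      then have "r' x = (\<lambda>P. 0)" by (simp add: r' r_def)
      then show ?thesis by (simp only: polynomial_functions.const)
    qed
  next
    fix l assume l: "\<forall>r\<in>R. (\<Sum>x\<in>J. r x P0 * l x) = 0"
    define f where "f = (\<lambda>e. \<chi> j. l (e, j))"
    have lf: "l x = f (fst x) $ snd x" for x by (simp add: f_def)
    have "f e = 0" if e: "e \<in> E" for e
    proof -
      have "f e \<in> range ((*v) (P0 v))" if v: "v \<in> e" for v
      proof -
        have g: "P0 v \<in> grassmannian s" using P0 E e v by (auto simp: PiE_iff)
        have "(P0 v *v f e - f e) $ i = 0" for i
        proof -
          have "r e v i \<in> R" using e v by (auto simp: R_def)
          then have "(\<Sum>x\<in>J. r e v i x P0 * f (fst x) $ snd x) = 0" using l lf by simp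
          then show ?thesis using sm[OF e, of v i P0 f] by simp
        qed
        then have "P0 v *v f e = f e" by (simp add: vec_eq_iff)
        then show ?thesis using grassmannian_range(3)[OF g] by blast
      qed
      moreover have "s' e \<in> e" "t e \<in> e" "s' e \<noteq> t e" using st[OF e] by blast+
      ultimately show ?thesis using dis[OF e] by blast
    qed
    then show "\<forall>x\<in>J. l x = 0" by (auto simp: J_def lf)
  qed
  then obtain q where q: "q \<in> polynomial_functions V" "q P0 \<noteq> 0"
    "\<And>P l. q P \<noteq> 0 \<Longrightarrow> \<forall>r\<in>R. (\<Sum>x\<in>J. r x P * l x) = 0 \<Longrightarrow> \<forall>x\<in>J. l x = 0" by blast
  have "range ((*v) (P u)) \<inter> range ((*v) (P v)) = {0}"
    if P: "P \<in> (\<Pi>\<^sub>E v\<in>V. grassmannian s)" and "q P \<noteq> 0" and e: "e \<in> E" "u \<in> e" "v \<in> e" "u \<noteq> v" for P e u v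
  proof -
    have g: "P u \<in> grassmannian s" "P v \<in> grassmannian s" using P E e by (auto simp: PiE_iff)
    have uv: "w = u \<or> w = v" if "w \<in> e" for w using st[OF e(1)] e(2-4) that by (metis insertE singletonD)
    have "x = 0" if x: "x \<in> range ((*v) (P u))" "x \<in> range ((*v) (P v))" for x
    proof -
      \<comment> \<open>A common vector of the two ranges at \<open>e\<close>, extended by 0 to the
        other edges, solves the system for all edges.\<close>
      define f where "f = (\<lambda>e'. if e' = e then x else 0)"
      have fix_x: "P u *v x = x" "P v *v x = x"
        using x grassmannian_range(3)[OF g(1)] grassmannian_range(3)[OF g(2)] by auto
      have "\<forall>r\<in>R. (\<Sum>x\<in>J. r x P * f (fst x) $ snd x) = 0"
      proof
        fix r' assume "r' \<in> R"
        then obtain e' w i where r': "r' = r e' w i" "e' \<in> E" "w \<in> e'" by (auto simp: R_def)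
        have "P w *v f e' = f e'" using uv[of w] r' fix_x by (auto simp: f_def)
        then show "(\<Sum>x\<in>J. r' x P * f (fst x) $ snd x) = 0" by (simp add: r'(1) sm[OF r'(2)])
      qed
      from q(3)[OF \<open>q P \<noteq> 0\<close> this] have "f e $ j = 0" for j using e(1) by (auto simp: J_def)
      then show "x = 0" by (simp add: f_def vec_eq_iff)
    qed
    then show ?thesis
      using subspace_0[OF grassmannian_range(1)[OF g(1)]] subspace_0[OF grassmannian_range(1)[OF g(2)]] by blast
  qed
  then show ?thesis using q by blast
qed

section \<open>The first cohomology of a motion sheaf\<close>

lemma zero_space_quotient_space_iff:
  assumes "abelian_group M" and N: "N \<subseteq> carrier M" "N \<noteq> {}"
  shows "zero_space (quotient_space M N) \<longleftrightarrow> N = carrier M"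
proof -
  interpret abelian_group M by fact
  have zs: "zero_space (quotient_space M N) \<longleftrightarrow> (\<lambda>x. N +>\<^bsub>M\<^esub> x) ` carrier M = {N}"
    by (simp add: zero_space_def quotient_space_def A_RCOSETS_def' UNION_singleton_eq_range)
  show ?thesis
  proof
    assume "zero_space (quotient_space M N)"
    then have eq: "N +>\<^bsub>M\<^esub> x = N" if "x \<in> carrier M" for x using that zs by blast
    obtain z where z: "z \<in> N" using N by blast
    have "x \<in> N" if x: "x \<in> carrier M" for x
    proof -
      have zc: "z \<in> carrier M" using z N by blast
      have "z \<oplus>\<^bsub>M\<^esub> (\<ominus>\<^bsub>M\<^esub> z \<oplus>\<^bsub>M\<^esub> x) \<in> N +>\<^bsub>M\<^esub> (\<ominus>\<^bsub>M\<^esub> z \<oplus>\<^bsub>M\<^esub> x)"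
        using z by (auto simp: a_r_coset_def')
      then have "z \<oplus>\<^bsub>M\<^esub> (\<ominus>\<^bsub>M\<^esub> z \<oplus>\<^bsub>M\<^esub> x) \<in> N"
        using eq x zc by simp
      then show ?thesis using x zc by (simp add: r_neg2)
    qed
    then show "N = carrier M" using N by blast
  next
    assume NM: "N = carrier M"
    have "N +>\<^bsub>M\<^esub> x = N" if x: "x \<in> carrier M" for x
    proof
      show "N +>\<^bsub>M\<^esub> x \<subseteq> N" using x NM by (auto simp: a_r_coset_def')
      show "N \<subseteq> N +>\<^bsub>M\<^esub> x"
      proof
        fix y assume y: "y \<in> N"
        have "(y \<oplus>\<^bsub>M\<^esub> \<ominus>\<^bsub>M\<^esub> x) \<oplus>\<^bsub>M\<^esub> x = y"
          using x y NM by (simp add: a_assoc l_neg)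
        moreover have "y \<oplus>\<^bsub>M\<^esub> \<ominus>\<^bsub>M\<^esub> x \<in> N" using x y NM by simp
        ultimately show "y \<in> N +>\<^bsub>M\<^esub> x" by (force simp: a_r_coset_def')
      qed
    qed
    then show "zero_space (quotient_space M N)" unfolding zs using zero_closed by blast
  qed
qed

lemma abelian_group_direct_sum:
  assumes M: "\<And>i. i \<in> I \<Longrightarrow> abelian_group (M i)"
  shows "abelian_group (direct_sum I M)"
proof (rule abelian_groupI)
  let ?D = "direct_sum I M"
  have M': "abelian_monoid (M i)" if "i \<in> I" for i using M[OF that] by (rule abelian_group.axioms)
  have mem: "x i \<in> carrier (M i)" if "x \<in> carrier ?D" "i \<in> I" for x i
    using that by (auto simp: direct_sum_def)
  have mk: "(\<lambda>i\<in>I. x i) \<in> carrier ?D" if "\<And>i. i \<in> I \<Longrightarrow> x i \<in> carrier (M i)" for x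
    using that by (auto simp: direct_sum_def)
  have add: "x \<oplus>\<^bsub>?D\<^esub> y = (\<lambda>i\<in>I. x i \<oplus>\<^bsub>M i\<^esub> y i)" for x y by (simp add: direct_sum_def)
  have zero: "\<zero>\<^bsub>?D\<^esub> = (\<lambda>i\<in>I. \<zero>\<^bsub>M i\<^esub>)" by (simp add: direct_sum_def)
  show closed: "x \<oplus>\<^bsub>?D\<^esub> y \<in> carrier ?D" if "x \<in> carrier ?D" "y \<in> carrier ?D" for x y
    unfolding add by (intro mk abelian_monoid.a_closed[OF M'] mem that)
  show "\<zero>\<^bsub>?D\<^esub> \<in> carrier ?D"
    unfolding zero by (intro mk abelian_monoid.zero_closed[OF M'])
  show "x \<oplus>\<^bsub>?D\<^esub> y \<oplus>\<^bsub>?D\<^esub> z = x \<oplus>\<^bsub>?D\<^esub> (y \<oplus>\<^bsub>?D\<^esub> z)"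
    if "x \<in> carrier ?D" "y \<in> carrier ?D" "z \<in> carrier ?D" for x y z
    unfolding add by (rule restrict_ext) (simp add: abelian_monoid.a_assoc[OF M'] mem that)
  show "x \<oplus>\<^bsub>?D\<^esub> y = y \<oplus>\<^bsub>?D\<^esub> x" if "x \<in> carrier ?D" "y \<in> carrier ?D" for x y
    unfolding add by (rule restrict_ext) (simp add: abelian_monoid.a_comm[OF M'] mem that)
  show "\<zero>\<^bsub>?D\<^esub> \<oplus>\<^bsub>?D\<^esub> x = x" if x: "x \<in> carrier ?D" for x
  proof (rule extensionalityI[of _ I])
    show "x \<in> extensional I" using x by (simp add: direct_sum_def PiE_iff)
  qed (use abelian_monoid.l_zero[OF M'] mem[OF x] in \<open>simp_all add: add zero\<close>)
  show "\<exists>y\<in>carrier ?D. y \<oplus>\<^bsub>?D\<^esub> x = \<zero>\<^bsub>?D\<^esub>" if x: "x \<in> carrier ?D" for x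
  proof
    show "(\<lambda>i\<in>I. \<ominus>\<^bsub>M i\<^esub> x i) \<in> carrier ?D"
      by (intro mk abelian_group.a_inv_closed[OF M] mem x)
    show "(\<lambda>i\<in>I. \<ominus>\<^bsub>M i\<^esub> x i) \<oplus>\<^bsub>?D\<^esub> x = \<zero>\<^bsub>?D\<^esub>"
      unfolding add zero by (rule restrict_ext) (simp add: abelian_group.l_neg[OF M] mem x)
  qed
qed

section \<open>Cosets of real subspaces and the coboundary of a motion sheaf\<close>

abbreviation vcoset :: "'a::real_vector set \<Rightarrow> 'a \<Rightarrow> 'a set"
  where "vcoset N x \<equiv> N +>\<^bsub>type_space\<^esub> x"

lemma vcoset_eq_iff:
  assumes "subspace N"
  shows "vcoset N x = vcoset N y \<longleftrightarrow> x - y \<in> N"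
proof -
  have mem: "z \<in> vcoset N x \<longleftrightarrow> z - x \<in> N" for z x
    by (auto simp: a_r_coset_def' type_space_def) (metis diff_add_cancel)
  show ?thesis
  proof
    assume "vcoset N x = vcoset N y"
    then show "x - y \<in> N" using mem[of x x] mem[of x y] subspace_0[OF assms] by simp
  next
    assume a: "x - y \<in> N"
    have "z - x \<in> N \<longleftrightarrow> z - y \<in> N" for z
      using subspace_add[OF assms _ a, of "z - x"] subspace_diff[OF assms _ a, of "z - y"] by auto
    then show "vcoset N x = vcoset N y" using mem by blast
  qed
qed

lemma carrier_quotient_type_space: "carrier (quotient_space type_space N) = range (vcoset N)"
  by (auto simp: quotient_space_def A_RCOSETS_def' type_space_def)

lemma vcoset_add:
  assumes "subspace N"
  shows "vcoset N x \<oplus>\<^bsub>quotient_space type_space N\<^esub> vcoset N y = vcoset N (x + y)"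
proof -
  interpret A: abelian_subgroup N type_space
    by (rule abelian_subgroup_submodule[OF module_type_space submodule_type_space[OF assms]])
  show ?thesis using A.a_rcos_sum[of x y] by (simp add: quotient_space_def type_space_def)
qed

lemma vcoset_smult:
  assumes "subspace N"
  shows "c \<odot>\<^bsub>quotient_space type_space N\<^esub> vcoset N x = vcoset N (c *\<^sub>R x)"
  using quotient_smult_coset[OF module_type_space submodule_type_space[OF assms], of x c]
  by (simp add: type_space_def)

lemma vcoset_reduction:
  assumes "subspace N" "subspace N'" "N \<subseteq> N'"
  shows "vcoset N x <+>\<^bsub>type_space\<^esub> N' = vcoset N' x"
proof (rule equalityI; rule subsetI)
  fix y assume "y \<in> vcoset N x <+>\<^bsub>type_space\<^esub> N'"
  then obtain s t where "s \<in> N" "t \<in> N'" "y = s + x + t"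
    by (auto simp: set_add_def' a_r_coset_def' type_space_def)
  then have "s + t \<in> N'" "y = (s + t) + x"
    using assms subspace_add[of N' s t] by (auto simp: algebra_simps)
  then show "y \<in> vcoset N' x"
    by (auto simp: a_r_coset_def' type_space_def)
next
  fix y assume "y \<in> vcoset N' x"
  then obtain t where "t \<in> N'" "y = 0 + x + t"
    by (auto simp: a_r_coset_def' type_space_def add.commute)
  moreover have "0 + x \<in> vcoset N x"
    using subspace_0[OF assms(1)] by (force simp: a_r_coset_def' type_space_def)
  ultimately show "y \<in> vcoset N x <+>\<^bsub>type_space\<^esub> N'"
    by (auto simp: set_add_def' type_space_def)
qed

text \<open>Cochains are replaced by representatives. At the incidence of \<open>v\<close> and
  \<open>e\<close> both restrictions end up modulo \<open>S v\<close>, where any representative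
  \<open>b\<close> of a coset of \<open>S' e\<close> may be used. The opposite signs turn the two
  terms into a difference, up to a common factor that can be moved to the target.\<close>

lemma zero_space_cohomology1_iff:
  fixes S :: "'v \<Rightarrow> 'a::real_vector set"
  assumes S: "\<And>v. v \<in> V \<Longrightarrow> subspace (S v)" and E: "\<And>e. e \<in> E \<Longrightarrow> e \<subseteq> V"
    and \<sigma>: "incidence_signs (incidence_graph V E) \<sigma>"
  shows "zero_space (cohomology1 (incidence_graph V E) (motion_sheaf S) \<sigma>) \<longleftrightarrow> coboundary_onto E S"
proof -
  let ?G = "incidence_graph V E" and ?F = "motion_sheaf S"
  let ?Q = "\<lambda>N :: 'a set. quotient_space type_space N"
  define S' where "S' = (\<lambda>e. \<Inter>v\<in>e. S v)"
  have S': "subspace (S' e)" if "e \<in> E" for e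
    using S E[OF that] by (auto simp: S'_def intro!: subspace_Inter)
  have edges: "edges ?G = {(v, e). e \<in> E \<and> v \<in> e}" using E by (auto simp: incidence_graph_def)
  have verts: "verts ?G = Inl ` V \<union> Inr ` E" by (simp add: incidence_graph_def)
  have est: "estalk ?F (v, e) = ?Q (S v)" for v e by (simp add: motion_sheaf_def)
  have vst: "vstalk ?F (Inl v) = ?Q (S v)" "vstalk ?F (Inr e) = ?Q (S' e)" for v e
    by (simp_all add: motion_sheaf_def S'_def)
  define \<tau> where "\<tau> = (\<lambda>v e. \<sigma> (Inl v) (v, e))"
  have sg: "\<sigma> (Inl v) (v, e) = \<tau> v e" "\<sigma> (Inr e) (v, e) = - \<tau> v e" "\<tau> v e * \<tau> v e = 1"
    if "e \<in> E" "v \<in> e" for v e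
  proof -
    have ve: "(v, e) \<in> edges ?G" using that by (simp add: edges)
    have en: "ends ?G (v, e) = {Inl v, Inr e}" by (simp add: incidence_graph_def)
    note signs = bspec[OF \<sigma>[unfolded incidence_signs_def] ve, unfolded en]
    have "\<sigma> (Inl v) (v, e) \<in> {1, -1}" using signs by blast
    moreover have "\<sigma> (Inr e) (v, e) = - \<sigma> (Inl v) (v, e)"
      using conjunct2[OF signs, rule_format, of "Inl v" "Inr e"] by simp
    ultimately show "\<sigma> (Inl v) (v, e) = \<tau> v e" "\<sigma> (Inr e) (v, e) = - \<tau> v e" "\<tau> v e * \<tau> v e = 1"
      by (auto simp: \<tau>_def)
  qed
  have grp: "abelian_group (?Q (S v))" if "v \<in> V" for v
    using module_quotient_space[OF module_type_space submodule_type_space[OF S[OF that]]]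
    by (simp add: module_def)
  have cob: "coboundary ?G ?F \<sigma> w (v, e) = vcoset (S v) (\<tau> v e *\<^sub>R (a - b))"
    if ev: "e \<in> E" "v \<in> e" and w: "w (Inl v) = vcoset (S v) a" "w (Inr e) = vcoset (S' e) b" for w v e a b
  proof -
    have vV: "v \<in> V" using ev E by blast
    interpret Q: abelian_group "?Q (S v)" by (rule grp[OF vV])
    have sub: "S' e \<subseteq> S v" using ev by (auto simp: S'_def)
    define h where "h = (\<lambda>x. \<sigma> x (v, e) \<odot>\<^bsub>?Q (S v)\<^esub> restr ?F x (v, e) (w x))"
    have h1: "h (Inl v) = vcoset (S v) (\<tau> v e *\<^sub>R a)"
      using sg[OF ev] by (simp add: h_def motion_sheaf_def w vcoset_smult S vV)
    have h2: "h (Inr e) = vcoset (S v) (- \<tau> v e *\<^sub>R b)"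
      using sg[OF ev] vcoset_reduction[OF S'[OF ev(1)] S[OF vV] sub, of b]
      by (simp add: h_def motion_sheaf_def w vcoset_smult S vV)
    have "h (Inl v) \<in> carrier (?Q (S v))" "h (Inr e) \<in> carrier (?Q (S v))"
      by (simp_all add: h1 h2 carrier_quotient_type_space)
    then have "(\<Oplus>\<^bsub>?Q (S v)\<^esub>x\<in>{Inl v, Inr e}. h x) = h (Inl v) \<oplus>\<^bsub>?Q (S v)\<^esub> h (Inr e)"
      by (subst Q.finsum_insert) auto
    also have "\<dots> = vcoset (S v) (\<tau> v e *\<^sub>R (a - b))"
      unfolding h1 h2 vcoset_add[OF S[OF vV]] by (simp add: algebra_simps)
    finally show ?thesis
      using ev by (simp add: coboundary_def edges est h_def) (simp add: incidence_graph_def)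
  qed
  define im where "im = coboundary ?G ?F \<sigma> ` carrier (cochains0 ?G ?F)"
  have c1: "carrier (cochains1 ?G ?F) = (\<Pi>\<^sub>E i\<in>edges ?G. range (vcoset (S (fst i))))"
    by (auto simp: cochains1_def direct_sum_def carrier_quotient_type_space motion_sheaf_def
        intro!: PiE_cong split: prod.split)
  have c0: "carrier (cochains0 ?G ?F) = (\<Pi>\<^sub>E i\<in>verts ?G. case i of Inl v \<Rightarrow> range (vcoset (S v)) | Inr e \<Rightarrow> range (vcoset (S' e)))"
    unfolding cochains0_def direct_sum_def partial_object.simps
    by (rule PiE_cong) (auto simp: vst carrier_quotient_type_space split: sum.split)
  have rep: "\<exists>a b. (\<forall>v\<in>V. w (Inl v) = vcoset (S v) (a v)) \<and> (\<forall>e\<in>E. w (Inr e) = vcoset (S' e) (b e))"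
    if "w \<in> carrier (cochains0 ?G ?F)" for w
  proof -
    have "\<forall>v\<in>V. \<exists>x. w (Inl v) = vcoset (S v) x" "\<forall>e\<in>E. \<exists>x. w (Inr e) = vcoset (S' e) x"
      using that unfolding c0 verts by (fastforce simp: PiE_iff)+
    then show ?thesis by metis
  qed
  have mk: "(\<lambda>i\<in>verts ?G. case i of Inl v \<Rightarrow> vcoset (S v) (a v) | Inr e \<Rightarrow> vcoset (S' e) (b e)) \<in> carrier (cochains0 ?G ?F)"
    for a b
    unfolding c0 by (rule restrict_PiE_iff[THEN iffD2]) (auto split: sum.split)
  have ext: "coboundary ?G ?F \<sigma> w \<in> extensional (edges ?G)" for w
    by (simp add: coboundary_def)
  have "im \<subseteq> carrier (cochains1 ?G ?F)"
  proof
    fix g assume "g \<in> im"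
    then obtain w where w: "w \<in> carrier (cochains0 ?G ?F)" "g = coboundary ?G ?F \<sigma> w"
      by (auto simp: im_def)
    obtain a b where ab: "\<forall>v\<in>V. w (Inl v) = vcoset (S v) (a v)" "\<forall>e\<in>E. w (Inr e) = vcoset (S' e) (b e)"
      using rep[OF w(1)] by blast
    have "g (v, e) \<in> range (vcoset (S v))" if "e \<in> E" "v \<in> e" for v e
      using cob[OF that, of w "a v" "b e"] ab that E w(2) by blast
    then show "g \<in> carrier (cochains1 ?G ?F)"
      unfolding c1 using ext w(2) by (auto simp: PiE_iff edges)
  qed
  moreover have "im \<noteq> {}" using mk by (auto simp: im_def)
  moreover have "abelian_group (cochains1 ?G ?F)"
    unfolding cochains1_def
  proof (rule abelian_group_direct_sum)
    fix i assume "i \<in> edges ?G"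
    then obtain v e where "i = (v, e)" "v \<in> V" using E by (auto simp: edges)
    then show "abelian_group (estalk ?F i)" using grp est by simp
  qed
  ultimately have "zero_space (cohomology1 ?G ?F \<sigma>) \<longleftrightarrow> im = carrier (cochains1 ?G ?F)"
    unfolding cohomology1_def im_def[symmetric] by (intro zero_space_quotient_space_iff)
  also have "\<dots> \<longleftrightarrow> carrier (cochains1 ?G ?F) \<subseteq> im"
    using \<open>im \<subseteq> carrier (cochains1 ?G ?F)\<close> by blast
  also have "\<dots> \<longleftrightarrow> coboundary_onto E S"
  proof
    assume onto: "carrier (cochains1 ?G ?F) \<subseteq> im"
    show "coboundary_onto E S"
      unfolding coboundary_onto_def
    proof
      fix y :: "'v \<Rightarrow> 'v set \<Rightarrow> 'a"
      \<comment> \<open>The target is premultiplied by the sign \<open>\<tau> v e\<close>, which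
        cancels the sign in the coboundary because its square is 1.\<close>
      define g where "g = (\<lambda>i\<in>edges ?G. vcoset (S (fst i)) (\<tau> (fst i) (snd i) *\<^sub>R y (fst i) (snd i)))"
      have "g \<in> carrier (cochains1 ?G ?F)" unfolding c1 g_def by auto
      then obtain w where w: "w \<in> carrier (cochains0 ?G ?F)" "g = coboundary ?G ?F \<sigma> w"
        using onto by (auto simp: im_def)
      obtain a b where ab: "\<forall>v\<in>V. w (Inl v) = vcoset (S v) (a v)" "\<forall>e\<in>E. w (Inr e) = vcoset (S' e) (b e)"
        using rep[OF w(1)] by blast
      have "a v - b e - y v e \<in> S v" if ev: "e \<in> E" "v \<in> e" for v e
      proof -
        have vV: "v \<in> V" using ev E by blast
        have "vcoset (S v) (\<tau> v e *\<^sub>R (a v - b e)) = vcoset (S v) (\<tau> v e *\<^sub>R y v e)"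
          using cob[OF ev, of w "a v" "b e"] ab ev vV w(2)[symmetric] by (simp add: g_def edges)
        then have "\<tau> v e *\<^sub>R (\<tau> v e *\<^sub>R (a v - b e) - \<tau> v e *\<^sub>R y v e) \<in> S v"
          using vcoset_eq_iff S vV subspace_scale by metis
        then show ?thesis using sg(3)[OF ev] by (simp add: scaleR_diff_right)
      qed
      then show "\<exists>a b. \<forall>e\<in>E. \<forall>v\<in>e. a v - b e - y v e \<in> S v" by blast
    qed
  next
    assume onto: "coboundary_onto E S"
    show "carrier (cochains1 ?G ?F) \<subseteq> im"
    proof
      fix g assume g: "g \<in> carrier (cochains1 ?G ?F)"
      then have "\<forall>i\<in>edges ?G. \<exists>y. g i = vcoset (S (fst i)) y" unfolding c1 by (fastforce simp: PiE_iff)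
      then obtain y where y: "\<And>i. i \<in> edges ?G \<Longrightarrow> g i = vcoset (S (fst i)) (y i)" by metis
      obtain a b where ab: "\<And>e v. e \<in> E \<Longrightarrow> v \<in> e \<Longrightarrow> a v - b e - \<tau> v e *\<^sub>R y (v, e) \<in> S v"
        using onto[unfolded coboundary_onto_def, rule_format, of "\<lambda>v e. \<tau> v e *\<^sub>R y (v, e)"] by blast
      define w where "w = (\<lambda>i\<in>verts ?G. case i of Inl v \<Rightarrow> vcoset (S v) (a v) | Inr e \<Rightarrow> vcoset (S' e) (b e))"
      have "coboundary ?G ?F \<sigma> w = g"
      proof (rule extensionalityI[OF ext])
        show "g \<in> extensional (edges ?G)" using g unfolding c1 by (simp add: PiE_iff)
        fix i assume i: "i \<in> edges ?G"
        obtain v e where ve: "i = (v, e)" "e \<in> E" "v \<in> e" using i by (auto simp: edges)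
        have vV: "v \<in> V" using ve E by blast
        have "\<tau> v e *\<^sub>R (a v - b e - \<tau> v e *\<^sub>R y (v, e)) \<in> S v"
          using ab[OF ve(2,3)] S[OF vV] by (rule subspace_scale[rotated])
        then have "\<tau> v e *\<^sub>R (a v - b e) - y (v, e) \<in> S v"
          using sg(3)[OF ve(2,3)] by (simp add: scaleR_diff_right)
        then have "vcoset (S v) (\<tau> v e *\<^sub>R (a v - b e)) = vcoset (S v) (y (v, e))"
          using vcoset_eq_iff[OF S[OF vV]] by blast
        then show "coboundary ?G ?F \<sigma> w i = g i"
          using cob[OF ve(2,3), of w "a v" "b e"] y[OF i] ve vV by (simp add: w_def verts)
      qed
      then show "g \<in> im" unfolding im_def using mk w_def by blast
    qed
  qed
  finally show ?thesis .
qed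

section \<open>Families of lines\<close>

lemma coboundary_onto_image_iff:
  assumes lin: "linear \<phi>" and "bij \<phi>" and E: "\<And>e. e \<in> E \<Longrightarrow> e \<subseteq> V"
    and S: "\<And>v. v \<in> V \<Longrightarrow> S v = \<phi> ` T v"
  shows "coboundary_onto E S \<longleftrightarrow> coboundary_onto E T"
proof -
  have inj: "inj \<phi>" and surj: "surj \<phi>" using \<open>bij \<phi>\<close> by (auto simp: bij_def)
  have iff: "\<phi> x - \<phi> y - \<phi> z \<in> S v \<longleftrightarrow> x - y - z \<in> T v" if "e \<in> E" "v \<in> e" for e v x y z
  proof -
    have "\<phi> x - \<phi> y - \<phi> z = \<phi> (x - y - z)" by (simp add: linear_diff[OF lin])
    moreover have "v \<in> V" using E that by blast
    ultimately show ?thesis by (simp add: S inj_image_mem_iff[OF inj])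
  qed
  obtain \<phi>' where inv: "\<And>x. \<phi> (\<phi>' x) = x" using surj by (metis surjD)
  show ?thesis
  proof
    assume on: "coboundary_onto E S"
    show "coboundary_onto E T"
      unfolding coboundary_onto_def
    proof
      fix y
      obtain a b where "\<forall>e\<in>E. \<forall>v\<in>e. a v - b e - \<phi> (y v e) \<in> S v"
        using on[unfolded coboundary_onto_def, rule_format, of "\<lambda>v e. \<phi> (y v e)"] by blast
      then have "\<forall>e\<in>E. \<forall>v\<in>e. \<phi> (\<phi>' (a v)) - \<phi> (\<phi>' (b e)) - \<phi> (y v e) \<in> S v"
        by (simp add: inv)
      then show "\<exists>a b. \<forall>e\<in>E. \<forall>v\<in>e. a v - b e - y v e \<in> T v" using iff by meson
    qed
  next
    assume on: "coboundary_onto E T"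
    show "coboundary_onto E S"
      unfolding coboundary_onto_def
    proof
      fix y
      obtain a b where "\<forall>e\<in>E. \<forall>v\<in>e. a v - b e - \<phi>' (y v e) \<in> T v"
        using on[unfolded coboundary_onto_def, rule_format, of "\<lambda>v e. \<phi>' (y v e)"] by blast
      then have "\<forall>e\<in>E. \<forall>v\<in>e. \<phi> (a v) - \<phi> (b e) - \<phi> (\<phi>' (y v e)) \<in> S v" using iff by blast
      then have "\<forall>e\<in>E. \<forall>v\<in>e. \<phi> (a v) - \<phi> (b e) - y v e \<in> S v" by (simp add: inv)
      then show "\<exists>a b. \<forall>e\<in>E. \<forall>v\<in>e. a v - b e - y v e \<in> S v"
        by (intro exI[of _ "\<lambda>v. \<phi> (a v)"] exI[of _ "\<lambda>e. \<phi> (b e)"])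
    qed
  qed
qed

text \<open>The sheaf lives in the ambient space \<open>'a\<close>, whereas stresses use the inner
  product of \<open>real^'n\<close>. Surjectivity is first transported along \<phi> and only then
  dualized.\<close>

lemma coboundary_onto_iff_stress_free:
  fixes \<phi> :: "real^'n \<Rightarrow> 'a::real_vector"
  assumes G: "simple_graph V E" and "linear \<phi>" "bij \<phi>"
    and T: "\<And>v. v \<in> V \<Longrightarrow> subspace (T v)" and S: "\<And>v. v \<in> V \<Longrightarrow> S v = \<phi> ` T v"
  shows "coboundary_onto E S \<longleftrightarrow> stress_free V E T"
proof -
  have "coboundary_onto E S \<longleftrightarrow> coboundary_onto E T"
    using G by (intro coboundary_onto_image_iff[OF assms(2,3) _ S]) (auto simp: simple_graph_def)
  then show ?thesis
    using coboundary_onto_imp_stress_free[OF G, of T] stress_free_imp_coboundary_onto[OF G, of T] T by blast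
qed

text \<open>Moving the term n to the left turns the inequality between integers into one between
  natural numbers without a possibly negative bound.\<close>

lemma sparse_multiple_graph_iff:
  assumes "3 \<le> n"
  shows "sparse_graph (n - 1) n (multiple_graph (n - 2) V E) \<longleftrightarrow>
    (\<forall>W\<subseteq>V. 2 \<le> card W \<longrightarrow> (n - 2) * card {e \<in> E. e \<subseteq> W} + n \<le> (n - 1) * card W)"
proof -
  have "{e \<in> E \<times> {..<n - 2}. fst e \<subseteq> W} = {e \<in> E. e \<subseteq> W} \<times> {..<n - 2}" for W by auto
  then have c: "card {e \<in> E \<times> {..<n - 2}. fst e \<subseteq> W} = (n - 2) * card {e \<in> E. e \<subseteq> W}" for W
    by (simp add: card_cartesian_product mult.commute)
  have "int ((n - 2) * card {e \<in> E. e \<subseteq> W}) \<le> int (n - 1) * int (card W) - int n \<longleftrightarrow>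
      (n - 2) * card {e \<in> E. e \<subseteq> W} + n \<le> (n - 1) * card W" for W
    unfolding of_nat_mult[symmetric] by linarith
  then show ?thesis by (simp only: sparse_graph_def multiple_graph_def multigraph.simps c)
qed

lemma line_family:
  fixes \<phi> :: "real^'n \<Rightarrow> 'a::real_vector"
  assumes lin: "linear \<phi>" and "inj \<phi>" and p: "\<And>v. p v \<noteq> 0"
  shows "(\<lambda>v\<in>V. \<phi> ` span {p v}) \<in> motion_sheaves 1 V"
proof -
  have "dim (\<phi> ` span {p v}) = 1" for v
  proof -
    have "dim (\<phi> ` span {p v}) = dim (span {p v})"
      by (rule dim_image_eq[OF lin]) (meson assms(2) inj_on_subset subset_UNIV)
    then show ?thesis using p[of v] by (simp add: dim_insert)
  qed
  then show ?thesis
    by (auto simp: motion_sheaves_def linear_subspace_image[OF lin])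
qed

lemma motion_sheaves_lines:
  fixes \<phi> :: "real^'n \<Rightarrow> 'a::real_vector"
  assumes lin: "linear \<phi>" and "bij \<phi>" and S: "S \<in> motion_sheaves 1 V"
  obtains p where "\<And>v. v \<in> V \<Longrightarrow> p v \<noteq> 0 \<and> S v = \<phi> ` span {p v}"
proof -
  have "\<exists>x. x \<noteq> 0 \<and> S v = \<phi> ` span {x}" if "v \<in> V" for v
  proof -
    have sub: "subspace (S v)" and d: "dim (S v) = 1"
      using S that by (auto simp: motion_sheaves_def PiE_iff)
    obtain B where B: "B \<subseteq> S v" "independent B" "S v \<subseteq> span B" "card B = dim (S v)"
      by (rule basis_exists)
    then obtain y where y: "B = {y}" using d by (metis card_1_singletonE)
    have "S v = span {y}" using B sub y by (metis span_minimal subset_antisym)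
    moreover obtain x where x: "\<phi> x = y" using \<open>bij \<phi>\<close> by (metis bij_pointE)
    moreover have "y \<noteq> 0" using B(2) y dependent_zero by blast
    ultimately show ?thesis
      using linear_span_image[OF lin, of "{x}"] linear_0[OF lin] by (intro exI[of _ x]) auto
  qed
  then show ?thesis using that by metis
qed

theorem mainTheorem1:
  fixes V :: "'v set" and E :: "'v set set" and n :: nat
    and \<phi> :: "real^'n \<Rightarrow> 'a::real_vector"
  assumes "simple_graph V E"
    and "n \<ge> 3"
    and "CARD('n) = n" and "linear \<phi>" and "bij \<phi>"
  shows "\<exists>U. zariski_open \<phi> 1 V U \<and> U \<noteq> {} \<and>
    (\<forall>S\<in>U. \<forall>\<sigma>. incidence_signs (incidence_graph V E) \<sigma> \<longrightarrow>
      (zero_space (cohomology1 (incidence_graph V E) (motion_sheaf S) \<sigma>) \<longleftrightarrow>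
       sparse_graph (n - 1) n (multiple_graph (n - 2) V E)))"
proof -
  note G = assms(1) and lin = assms(4) and bij = assms(5)
  have inj: "inj \<phi>" using bij by (simp add: bij_def)
  have n3: "3 \<le> CARD('n)" using assms(2,3) by simp
  have V: "finite V" and E: "\<And>e. e \<in> E \<Longrightarrow> e \<subseteq> V"
    using G by (auto simp: simple_graph_def)
  have coh: "zero_space (cohomology1 (incidence_graph V E) (motion_sheaf S) \<sigma>) \<longleftrightarrow> coboundary_onto E S"
    if "S \<in> motion_sheaves 1 V" "incidence_signs (incidence_graph V E) \<sigma>" for S :: "'v \<Rightarrow> 'a set" and \<sigma>
    using that by (intro zero_space_cohomology1_iff[OF _ E]) (auto simp: motion_sheaves_def PiE_iff)
  note sp = sparse_multiple_graph_iff[OF n3, of V E, unfolded assms(3)]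
  show ?thesis
  \<comment> \<open>The open set may depend on which truth value the equivalence has to take. For a
    sparse graph it is the set of all sheaves with vanishing cohomology, which is open and contains
    the constructed family. For any other graph it is the set of families with distinct lines along
    every edge, on which vanishing would imply sparsity.\<close>
  proof (cases "sparse_graph (n - 1) n (multiple_graph (n - 2) V E)")
    case True
    then have sparse: "(CARD('n) - 2) * card {e \<in> E. e \<subseteq> W} + CARD('n) \<le> (CARD('n) - 1) * card W"
      if "W \<subseteq> V" "2 \<le> card W" for W
      using sp that assms(3) by simp
    define U where "U = {S \<in> motion_sheaves 1 V. coboundary_onto E (S :: 'v \<Rightarrow> 'a set)}"
    have iff: "coboundary_onto E (subspace_family \<phi> V P) \<longleftrightarrow> stress_free V E (\<lambda>v. range ((*v) (P v)))"
      if "P \<in> (\<Pi>\<^sub>E v\<in>V. grassmannian 1)" for P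
    proof (rule coboundary_onto_iff_stress_free[OF G lin bij])
      fix v assume "v \<in> V"
      then show "subspace (range ((*v) (P v)))"
        using that grassmannian_range(1)[of "P v" 1] by (auto simp: PiE_iff)
    qed (simp add: subspace_family_def)
    have "zariski_open \<phi> 1 V U"
      unfolding U_def
    proof (rule zariski_openI[OF lin inj])
      fix P assume P: "P \<in> (\<Pi>\<^sub>E v\<in>V. grassmannian 1)" and "coboundary_onto E (subspace_family \<phi> V P)"
      then have "stress_free V E (\<lambda>v. range ((*v) (P v)))" using iff by blast
      from stress_free_open[OF G P this]
      show "\<exists>q\<in>polynomial_functions V. q P \<noteq> 0 \<and> (\<forall>P'\<in>(\<Pi>\<^sub>E v\<in>V. grassmannian 1).
          q P' \<noteq> 0 \<longrightarrow> coboundary_onto E (subspace_family \<phi> V P'))"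
        using iff by blast
    qed
    moreover obtain p :: "'v \<Rightarrow> real^'n" where p: "\<And>v. p v \<noteq> 0" "stress_free V E (\<lambda>v. span {p v})"
      using exists_stress_free[OF G n3 sparse] by blast
    have "coboundary_onto E (\<lambda>v\<in>V. \<phi> ` span {p v})"
      using coboundary_onto_iff_stress_free[OF G lin bij, of "\<lambda>v. span {p v}" "\<lambda>v\<in>V. \<phi> ` span {p v}"] p(2)
      by simp
    then have "(\<lambda>v\<in>V. \<phi> ` span {p v}) \<in> U"
      unfolding U_def by (intro CollectI conjI line_family[OF lin inj p(1)])
    then have "U \<noteq> {}" by auto
    ultimately show ?thesis using True coh by (intro exI[of _ U]) (auto simp: U_def)
  next
    case False
    define dis where "dis = (\<lambda>S :: 'v \<Rightarrow> 'a set. \<forall>e\<in>E. \<forall>u\<in>e. \<forall>v\<in>e. u \<noteq> v \<longrightarrow> S u \<inter> S v = {0})"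
    define U where "U = {S \<in> motion_sheaves 1 V. dis S}"
    have iff: "dis (subspace_family \<phi> V P) \<longleftrightarrow>
        (\<forall>e\<in>E. \<forall>u\<in>e. \<forall>v\<in>e. u \<noteq> v \<longrightarrow> range ((*v) (P u)) \<inter> range ((*v) (P v)) = {0})" for P
    proof -
      have "subspace_family \<phi> V P u \<inter> subspace_family \<phi> V P v = {0} \<longleftrightarrow>
          range ((*v) (P u)) \<inter> range ((*v) (P v)) = {0}" if "e \<in> E" "u \<in> e" "v \<in> e" for e u v
      proof -
        have uv: "u \<in> V" "v \<in> V" using E that by auto
        have "\<phi> ` A = {0} \<longleftrightarrow> A = {0}" for A
          using inj_image_eq_iff[OF inj, of A "{0}"] linear_0[OF lin] by simp
        then show ?thesis
          using uv by (simp add: subspace_family_def flip: image_Int[OF inj])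
      qed
      then show ?thesis unfolding dis_def by meson
    qed
    have "zariski_open \<phi> 1 V U"
      unfolding U_def
    proof (rule zariski_openI[OF lin inj])
      fix P assume P: "P \<in> (\<Pi>\<^sub>E v\<in>V. grassmannian 1)" and "dis (subspace_family \<phi> V P)"
      then have d: "range ((*v) (P u)) \<inter> range ((*v) (P v)) = {0}"
        if "e \<in> E" "u \<in> e" "v \<in> e" "u \<noteq> v" for e u v
        using iff that by blast
      show "\<exists>q\<in>polynomial_functions V. q P \<noteq> 0 \<and> (\<forall>P'\<in>(\<Pi>\<^sub>E v\<in>V. grassmannian 1).
          q P' \<noteq> 0 \<longrightarrow> dis (subspace_family \<phi> V P'))"
        unfolding iff by (rule distinct_lines_open[OF G P]) (rule d)
    qed
    moreover have "U \<noteq> {}"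
    proof -
      obtain c :: "'v \<Rightarrow> nat" where c: "inj_on c V" using V finite_imp_inj_to_nat_seg by blast
      obtain k l :: 'n where kl: "k \<noteq> l" using n3 card_2_iff' ex_card[of 2 "UNIV :: 'n set"]
        by (metis (full_types) Suc_leD eval_nat_numeral(3))
      \<comment> \<open>Points at distinct heights on an affine line that misses the origin: the
        common entry 1 at \<open>k\<close> prevents any two of them from being proportional.\<close>
      define p where "p = (\<lambda>v. axis k 1 + real (c v) *\<^sub>R axis l (1::real))"
      have pk: "p v $ k = 1" "p v $ l = real (c v)" for v using kl by (simp_all add: p_def axis_def)
      have p0: "p v \<noteq> 0" for v using pk(1)[of v] by auto
      have "span {p u} \<inter> span {p v} = {0}" if "u \<in> V" "v \<in> V" "u \<noteq> v" for u v
      proof -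
        have "x = 0" if x: "x \<in> span {p u}" "x \<in> span {p v}" for x
        proof -
          obtain a where "x = a *\<^sub>R p u" using x(1) unfolding span_singleton by blast
          moreover obtain b where "x = b *\<^sub>R p v" using x(2) unfolding span_singleton by blast
          ultimately have ab: "x = a *\<^sub>R p u" "x = b *\<^sub>R p v" .
          have "x $ k = a" "x $ k = b" "x $ l = a * c u" "x $ l = b * c v"
            using pk ab by (metis mult.right_neutral vector_scaleR_component real_scaleR_def)+
          moreover have "c u \<noteq> c v" using c \<open>u \<in> V\<close> \<open>v \<in> V\<close> \<open>u \<noteq> v\<close> by (auto simp: inj_on_def)
          ultimately have "a = 0" by auto
          then show "x = 0" using ab by simp
        qed
        then show ?thesis using span_0 by blast
      qed
      then have "\<phi> ` span {p u} \<inter> \<phi> ` span {p v} = {0}" if "u \<in> V" "v \<in> V" "u \<noteq> v" for u v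
        using that linear_0[OF lin] by (simp flip: image_Int[OF inj])
      then have "dis (\<lambda>v\<in>V. \<phi> ` span {p v})"
        unfolding dis_def using E by (metis (no_types, lifting) restrict_apply' subsetD)
      then have "(\<lambda>v\<in>V. \<phi> ` span {p v}) \<in> U"
        unfolding U_def by (intro CollectI conjI line_family[OF lin inj p0])
      then show ?thesis by auto
    qed
    moreover have "\<not> coboundary_onto E S" if S: "S \<in> U" for S
    proof
      assume on: "coboundary_onto E S"
      have SU: "S \<in> motion_sheaves 1 V" "dis S" using S by (auto simp: U_def)
      obtain p :: "'v \<Rightarrow> real^'n" where p: "\<And>v. v \<in> V \<Longrightarrow> p v \<noteq> 0 \<and> S v = \<phi> ` span {p v}"
        by (rule motion_sheaves_lines[OF lin bij SU(1)]) blast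
      have "p u \<notin> span {p v}" if e: "e \<in> E" "u \<in> e" "v \<in> e" "u \<noteq> v" for e u v
      proof
        assume "p u \<in> span {p v}"
        moreover have uv: "u \<in> V" "v \<in> V" using E e by auto
        ultimately have "\<phi> (p u) \<in> S u \<inter> S v" using p by (auto intro: span_base)
        moreover have "S u \<inter> S v = {0}" using SU(2) e unfolding dis_def by blast
        ultimately have "\<phi> (p u) = \<phi> 0" using linear_0[OF lin] by auto
        then show False using inj p[OF uv(1)] by (simp add: inj_eq)
      qed
      moreover have "stress_free V E (\<lambda>v. span {p v})"
        using coboundary_onto_iff_stress_free[OF G lin bij, of "\<lambda>v. span {p v}" S] p on by simp
      ultimately have "(CARD('n) - 2) * card {e \<in> E. e \<subseteq> W} + CARD('n) \<le> (CARD('n) - 1) * card W"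
        if "W \<subseteq> V" "2 \<le> card W" for W
        using stress_free_imp_sparse[OF G n3] p that by blast
      then show False using False sp assms(3) by simp
    qed
    ultimately show ?thesis using False coh by (intro exI[of _ U]) (auto simp: U_def)
  qed
qed

end
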